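(* Let $\mathcal{K}=\mathcal{K}(\mathcal{H})$ be the $C^*$-algebra of all compact operators on a Hilbert space $\mathcal{H}$, let $E$ be a Hilbert $\mathcal{K}$-module and let $T\in B(E)$. Then $T$ is Fredholm if and only if the range of $T$ is a closed submodule of $E$ and both $\dim_{\mathcal{K}} \operatorname{Ker} T$ and $\dim_{\mathcal{K}} \operatorname{Ker} T^*$ are finite.
   Context: A (left) Hilbert $\mathcal{A}$-module $E$ over a $C^*$-algebra $\mathcal{A}$ is a left $\mathcal{A}$-module with an $\mathcal{A}$-valued inner product $\langle\cdot,\cdot\rangle$, $\mathcal{A}$-linear in the first variable, with $\langle x,y\rangle=\langle y,x\rangle^*$, $\langle x,x\rangle\ge 0$ with equality iff $x=0$, complete for the norm $\|x\|=\|\langle x,x\rangle\|^{1/2}$. $B(E)$ is the $C^*$-algebra of adjointable operators on $E$ (maps $T$ with some $T^*$ satisfying $\langle Tx,y\rangle=\langle x,T^*y\rangle$). For $x,y\in E$, $\Theta_{x,y}(z)=\langle z,x\rangle y$; $K(E)$ is the closed linear span of $\{\Theta_{x,y}:x,y\in E\}$ in $B(E)$. An operator $T\in B(E)$ is Fredholm if there exists $S\in B(E)$ with $ST-1\in K(E)$ and $TS-1\in K(E)$. For a Hilbert $\mathcal{K}$-module $X$ (e.g. a closed submodule of $E$), an orthonormal system is a family $(x_\lambda)$ in $X$ such that each $\langle x_\lambda,x_\lambda\rangle$ is a minimal projection in $\mathcal{K}$ and $\langle x_\lambda,x_\mu\rangle=0$ for $\lambda\ne\mu$; it is an orthonormal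 basis if it generates a dense submodule of $X$. Every Hilbert $\mathcal{K}$-module has an orthonormal basis and all orthonormal bases have the same cardinality; this cardinal is denoted $\dim_{\mathcal{K}} X$. $\operatorname{Ker}$ denotes the kernel. *)

theory Defs
  imports "HOL-Analysis.Analysis"
begin

(* HOL has no class of complex vector spaces, so complex scalar multiplications
   are passed explicitly; addition, norm and topology come from the types. *)

definition complex_hilbert_space ::
  "(complex \<Rightarrow> 'h::banach \<Rightarrow> 'h) \<Rightarrow> ('h \<Rightarrow> 'h \<Rightarrow> complex) \<Rightarrow> bool" where
  "complex_hilbert_space sc ip \<longleftrightarrow>
     Vector_Spaces.vector_space sc \<and>
     (\<forall>r x. scaleR r x = sc (complex_of_real r) x) \<and>
     (\<forall>x y z. ip (x + y) z = ip x z + ip y z) \<and>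
     (\<forall>c x y. ip (sc c x) y = c * ip x y) \<and>
     (\<forall>x y. ip x y = cnj (ip y x)) \<and>
     (\<forall>x. norm x = sqrt (Re (ip x x)))"

definition adjH :: "('h \<Rightarrow> 'h \<Rightarrow> complex) \<Rightarrow> ('h \<Rightarrow> 'h) \<Rightarrow> ('h \<Rightarrow> 'h)" where
  "adjH ip A = (SOME B. \<forall>x y. ip (A x) y = ip x (B y))"

definition compact_ops :: "(complex \<Rightarrow> 'h::real_normed_vector \<Rightarrow> 'h) \<Rightarrow> ('h \<Rightarrow> 'h) set" where
  "compact_ops sc = {A. Vector_Spaces.linear sc sc A \<and> bounded_linear A \<and>
                        compact (closure (A ` ball 0 1))}"

definition positive_op :: "('h \<Rightarrow> 'h \<Rightarrow> complex) \<Rightarrow> ('h \<Rightarrow> 'h) \<Rightarrow> bool" where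
  "positive_op ip A \<longleftrightarrow> (\<forall>h. Im (ip (A h) h) = 0 \<and> 0 \<le> Re (ip (A h) h))"

definition projection_in_K ::
  "(complex \<Rightarrow> 'h::real_normed_vector \<Rightarrow> 'h) \<Rightarrow> ('h \<Rightarrow> 'h \<Rightarrow> complex) \<Rightarrow> ('h \<Rightarrow> 'h) \<Rightarrow> bool" where
  "projection_in_K sc ip p \<longleftrightarrow> p \<in> compact_ops sc \<and> p \<circ> p = p \<and> adjH ip p = p"

definition minimal_projection ::
  "(complex \<Rightarrow> 'h::real_normed_vector \<Rightarrow> 'h) \<Rightarrow> ('h \<Rightarrow> 'h \<Rightarrow> complex) \<Rightarrow> ('h \<Rightarrow> 'h) \<Rightarrow> bool" where
  "minimal_projection sc ip p \<longleftrightarrow> projection_in_K sc ip p \<and> p \<noteq> (\<lambda>_. 0) \<and>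
     (\<forall>q. projection_in_K sc ip q \<and> q \<circ> p = q \<longrightarrow> q = (\<lambda>_. 0) \<or> q = p)"

(* E with complex scalar multiplication scE, left action act of K(H) and
   K(H)-valued inner product ipE; the norm of E is the one induced by ipE
   (operator norm on K(H)) and E is complete (class banach). *)
definition hilbert_K_module ::
  "(complex \<Rightarrow> 'h::banach \<Rightarrow> 'h) \<Rightarrow> ('h \<Rightarrow> 'h \<Rightarrow> complex) \<Rightarrow>
   (complex \<Rightarrow> 'e::banach \<Rightarrow> 'e) \<Rightarrow> (('h \<Rightarrow> 'h) \<Rightarrow> 'e \<Rightarrow> 'e) \<Rightarrow> ('e \<Rightarrow> 'e \<Rightarrow> ('h \<Rightarrow> 'h)) \<Rightarrow> bool" where
  "hilbert_K_module scH ipH scE act ipE \<longleftrightarrow>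
     complex_hilbert_space scH ipH \<and>
     Vector_Spaces.vector_space scE \<and>
     (\<forall>r x. scaleR r x = scE (complex_of_real r) x) \<and>
     \<comment> \<open>left module over the complex algebra K(H)\<close>
     (\<forall>a\<in>compact_ops scH. \<forall>b\<in>compact_ops scH. \<forall>x. act (a \<circ> b) x = act a (act b x)) \<and>
     (\<forall>a\<in>compact_ops scH. \<forall>b\<in>compact_ops scH. \<forall>x. act (\<lambda>h. a h + b h) x = act a x + act b x) \<and>
     (\<forall>a\<in>compact_ops scH. \<forall>x y. act a (x + y) = act a x + act a y) \<and>
     (\<forall>a\<in>compact_ops scH. \<forall>c x. act (\<lambda>h. scH c (a h)) x = scE c (act a x)) \<and>
     (\<forall>a\<in>compact_ops scH. \<forall>c x. act a (scE c x) = scE c (act a x)) \<and>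
     \<comment> \<open>K(H)-valued inner product, linear in the first variable\<close>
     (\<forall>x y. ipE x y \<in> compact_ops scH) \<and>
     (\<forall>x y z. ipE (x + y) z = (\<lambda>h. ipE x z h + ipE y z h)) \<and>
     (\<forall>c x y. ipE (scE c x) y = (\<lambda>h. scH c (ipE x y h))) \<and>
     (\<forall>a\<in>compact_ops scH. \<forall>x y. ipE (act a x) y = a \<circ> ipE x y) \<and>
     (\<forall>x y. ipE x y = adjH ipH (ipE y x)) \<and>
     (\<forall>x. positive_op ipH (ipE x x)) \<and>
     (\<forall>x. ipE x x = (\<lambda>_. 0) \<longleftrightarrow> x = 0) \<and>
     (\<forall>x. norm x = sqrt (onorm (ipE x x)))"

definition adjointable :: "('e \<Rightarrow> 'e \<Rightarrow> ('h \<Rightarrow> 'h)) \<Rightarrow> ('e \<Rightarrow> 'e) \<Rightarrow> bool" where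
  "adjointable ipE T \<longleftrightarrow> (\<exists>S. \<forall>x y. ipE (T x) y = ipE x (S y))"

definition adjE :: "('e \<Rightarrow> 'e \<Rightarrow> ('h \<Rightarrow> 'h)) \<Rightarrow> ('e \<Rightarrow> 'e) \<Rightarrow> ('e \<Rightarrow> 'e)" where
  "adjE ipE T = (SOME S. \<forall>x y. ipE (T x) y = ipE x (S y))"

definition Theta :: "(('h \<Rightarrow> 'h) \<Rightarrow> 'e \<Rightarrow> 'e) \<Rightarrow> ('e \<Rightarrow> 'e \<Rightarrow> ('h \<Rightarrow> 'h)) \<Rightarrow> 'e \<Rightarrow> 'e \<Rightarrow> ('e \<Rightarrow> 'e)" where
  "Theta act ipE x y = (\<lambda>z. act (ipE z x) y)"

definition Theta_span ::
  "(complex \<Rightarrow> 'e::real_normed_vector \<Rightarrow> 'e) \<Rightarrow> (('h \<Rightarrow> 'h) \<Rightarrow> 'e \<Rightarrow> 'e) \<Rightarrow> ('e \<Rightarrow> 'e \<Rightarrow> ('h \<Rightarrow> 'h)) \<Rightarrow> ('e \<Rightarrow> 'e) set" where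
  "Theta_span scE act ipE =
     {F. \<exists>n c xs ys. F = (\<lambda>z. \<Sum>i<(n::nat). scE (c i) (Theta act ipE (xs i) (ys i) z))}"

definition compact_ops_E ::
  "(complex \<Rightarrow> 'e::real_normed_vector \<Rightarrow> 'e) \<Rightarrow> (('h \<Rightarrow> 'h) \<Rightarrow> 'e \<Rightarrow> 'e) \<Rightarrow> ('e \<Rightarrow> 'e \<Rightarrow> ('h \<Rightarrow> 'h)) \<Rightarrow> ('e \<Rightarrow> 'e) set" where
  "compact_ops_E scE act ipE =
     {T. adjointable ipE T \<and>
         (\<forall>\<epsilon>>0. \<exists>F\<in>Theta_span scE act ipE. onorm (\<lambda>z. T z - F z) < \<epsilon>)}"

definition fredholm ::
  "(complex \<Rightarrow> 'e::real_normed_vector \<Rightarrow> 'e) \<Rightarrow> (('h \<Rightarrow> 'h) \<Rightarrow> 'e \<Rightarrow> 'e) \<Rightarrow> ('e \<Rightarrow> 'e \<Rightarrow> ('h \<Rightarrow> 'h)) \<Rightarrow> ('e \<Rightarrow> 'e) \<Rightarrow> bool" where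
  "fredholm scE act ipE T \<longleftrightarrow>
     (\<exists>S. adjointable ipE S \<and>
          (\<lambda>z. S (T z) - z) \<in> compact_ops_E scE act ipE \<and>
          (\<lambda>z. T (S z) - z) \<in> compact_ops_E scE act ipE)"

definition submodule ::
  "(complex \<Rightarrow> 'h::real_normed_vector \<Rightarrow> 'h) \<Rightarrow> (complex \<Rightarrow> 'e::real_normed_vector \<Rightarrow> 'e) \<Rightarrow> (('h \<Rightarrow> 'h) \<Rightarrow> 'e \<Rightarrow> 'e) \<Rightarrow> 'e set \<Rightarrow> bool" where
  "submodule scH scE act X \<longleftrightarrow> 0 \<in> X \<and> (\<forall>x\<in>X. \<forall>y\<in>X. x + y \<in> X) \<and>
     (\<forall>c. \<forall>x\<in>X. scE c x \<in> X) \<and> (\<forall>a\<in>compact_ops scH. \<forall>x\<in>X. act a x \<in> X)"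

definition orthonormal_system ::
  "(complex \<Rightarrow> 'h::real_normed_vector \<Rightarrow> 'h) \<Rightarrow> ('h \<Rightarrow> 'h \<Rightarrow> complex) \<Rightarrow> ('e \<Rightarrow> 'e \<Rightarrow> ('h \<Rightarrow> 'h)) \<Rightarrow> 'e set \<Rightarrow> 'e set \<Rightarrow> bool" where
  "orthonormal_system scH ipH ipE X B \<longleftrightarrow> B \<subseteq> X \<and>
     (\<forall>b\<in>B. minimal_projection scH ipH (ipE b b)) \<and>
     (\<forall>b\<in>B. \<forall>b'\<in>B. b \<noteq> b' \<longrightarrow> ipE b b' = (\<lambda>_. 0))"

definition generated_submodule ::
  "(complex \<Rightarrow> 'h::real_normed_vector \<Rightarrow> 'h) \<Rightarrow> (('h \<Rightarrow> 'h) \<Rightarrow> 'e::real_normed_vector \<Rightarrow> 'e) \<Rightarrow> 'e set \<Rightarrow> 'e set" where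
  "generated_submodule scH act B =
     {\<Sum>i<(n::nat). act (a i) (bs i) | n a bs. \<forall>i<n. a i \<in> compact_ops scH \<and> bs i \<in> B}"

definition orthonormal_basis ::
  "(complex \<Rightarrow> 'h::real_normed_vector \<Rightarrow> 'h) \<Rightarrow> ('h \<Rightarrow> 'h \<Rightarrow> complex) \<Rightarrow> (('h \<Rightarrow> 'h) \<Rightarrow> 'e::real_normed_vector \<Rightarrow> 'e) \<Rightarrow> ('e \<Rightarrow> 'e \<Rightarrow> ('h \<Rightarrow> 'h)) \<Rightarrow> 'e set \<Rightarrow> 'e set \<Rightarrow> bool" where
  "orthonormal_basis scH ipH act ipE X B \<longleftrightarrow> orthonormal_system scH ipH ipE X B \<and>
     X \<subseteq> closure (generated_submodule scH act B)"

(* dim_K X is the cardinality of (any, hence a chosen) orthonormal basis of X;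
   "dim_K X is finite" *)
definition finite_dimK ::
  "(complex \<Rightarrow> 'h::real_normed_vector \<Rightarrow> 'h) \<Rightarrow> ('h \<Rightarrow> 'h \<Rightarrow> complex) \<Rightarrow> (('h \<Rightarrow> 'h) \<Rightarrow> 'e::real_normed_vector \<Rightarrow> 'e) \<Rightarrow> ('e \<Rightarrow> 'e \<Rightarrow> ('h \<Rightarrow> 'h)) \<Rightarrow> 'e set \<Rightarrow> bool" where
  "finite_dimK scH ipH act ipE X \<longleftrightarrow> finite (SOME B. orthonormal_basis scH ipH act ipE X B)"

end

theory Submission
  imports Defs
begin

text \<open>
  Fix a unit vector \<open>h\<^sub>0\<close> of \<open>H\<close> and let \<open>e\<close> be the projection onto its span. Then \<open>G = eE\<close> is a
  Hilbert space under \<open>\<phi>(x, y) = (\<langle>x, y\<rangle> h\<^sub>0, h\<^sub>0)\<close>, adjointable operators leave it invariant, and the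
  maps \<open>x \<mapsto> x\<^sub>h = (h\<^sub>0 \<otimes> h) x\<close> from \<open>E\<close> to \<open>G\<close> satisfy \<open>\<parallel>x\<parallel> = sup \<parallel>x\<^sub>h\<parallel>\<close> over unit vectors \<open>h\<close>. Orthogonal
  projections in \<open>G\<close> give a nonzero vector orthogonal to any proper closed submodule, hence orthonormal
  bases, and elements of \<open>K(E)\<close> restrict to compact operators on \<open>G\<close>.

  If \<open>ST - 1\<close> and \<open>TS - 1\<close> lie in \<open>K(E)\<close>, an infinite orthonormal system in \<open>Ker T\<close> or \<open>Ker T\<^sup>*\<close> would be
  mapped by one of them to a uniformly separated set, contradicting compactness. Compactness on \<open>G\<close> also
  shows that \<open>T\<close> is bounded below on the complement of its kernel, first on \<open>G\<close>, then on \<open>E\<close> through the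
  maps \<open>x \<mapsto> x\<^sub>h\<close>; so its range is closed.

  Conversely, let \<open>Q\<close> and \<open>Q'\<close> be the finite-rank projections onto \<open>Ker T\<close> and \<open>Ker T\<^sup>*\<close>. By the open
  mapping theorem the self-adjoint operator \<open>T\<^sup>*T + Q\<close> is bounded below, hence bijective, and
  \<open>S = (T\<^sup>*T + Q)\<^sup>-\<^sup>1 T\<^sup>*\<close> satisfies \<open>ST - 1 = -Q\<close> and \<open>TS - 1 = -Q'\<close>.
\<close>

section \<open>The open mapping theorem\<close>

lemma open_mapping_closed_subspace_approx:
  fixes f :: "'a::banach \<Rightarrow> 'b::banach"
  assumes f: "bounded_linear f" and V: "subspace V" and R: "closed (f ` V)"
  shows "\<exists>C\<ge>0. \<forall>y\<in>f ` V. \<exists>x\<in>V. norm x \<le> C * norm y \<and> norm (f x - y) \<le> norm y / 2"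
proof -
  interpret f: bounded_linear f by fact
  define D where "D n = closure (f ` (V \<inter> ball 0 (real n)))" for n
  have sub: "D n \<subseteq> f ` V" for n
    unfolding D_def by (rule closure_minimal) (use R in auto)
  have un: "\<Union>(range D) = f ` V"
  proof
    show "\<Union>(range D) \<subseteq> f ` V" using sub by auto
    show "f ` V \<subseteq> \<Union>(range D)"
    proof
      fix y assume "y \<in> f ` V"
      then obtain x where x: "x \<in> V" "y = f x" by auto
      obtain n where "norm x < real n" using reals_Archimedean2 by blast
      then have "y \<in> D n"
        unfolding D_def using x by (intro subsetD[OF closure_subset]) auto
      then show "y \<in> \<Union>(range D)" by auto
    qed
  qed
  have "\<exists>n. top_of_set (f ` V) interior_of (D n) \<noteq> {}"
  proof (rule ccontr)
    assume a: "\<nexists>n. top_of_set (f ` V) interior_of (D n) \<noteq> {}"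
    have "top_of_set (f ` V) interior_of (\<Union>(range D)) = {}"
    proof (rule Baire_category_alt)
      show "completely_metrizable_space (top_of_set (f ` V)) \<or>
            locally_compact_space (top_of_set (f ` V)) \<and> regular_space (top_of_set (f ` V))"
        using R closed_closedin completely_metrizable_space_closedin
          completely_metrizable_space_euclidean by blast
      show "closedin (top_of_set (f ` V)) T \<and> top_of_set (f ` V) interior_of T = {}"
        if TD: "T \<in> range D" for T
      proof -
        obtain n where "T = D n" using TD by auto
        then show ?thesis using a sub[of n] by (auto intro: closed_subset simp: D_def)
      qed
    qed auto
    then have "f ` V = {}"
      using interior_of_topspace[of "top_of_set (f ` V)"] by (simp add: un)
    then show False using V subspace_0 by auto
  qed
  then obtain n y0 where "y0 \<in> top_of_set (f ` V) interior_of (D n)" by blast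
  then obtain U where U: "openin (top_of_set (f ` V)) U" "y0 \<in> U" "U \<subseteq> D n"
    by (auto simp: interior_of_def)
  then obtain r where r: "r > 0" "ball y0 r \<inter> f ` V \<subseteq> U" and y0: "y0 \<in> f ` V"
    unfolding openin_contains_ball by blast
  have fV: "subspace (f ` V)"
    using V by (rule linear_subspace_image[OF f.linear])
  \<comment> \<open>Both \<open>y0 + y\<close> and \<open>y0\<close> lie in \<open>D n\<close>, so
    \<open>y\<close> is approximated by a difference \<open>f u - f v\<close>; this accounts for the
    bound \<open>2 * real n\<close>.\<close>
  have small: "\<exists>x\<in>V. norm x \<le> 2 * real n \<and> norm (f x - y) \<le> d"
    if y: "y \<in> f ` V" "norm y < r" and d: "d > 0" for y d
  proof -
    have "y0 + y \<in> D n"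
      using r(2) U(3) y y0 fV by (auto simp: subset_eq dist_norm subspace_add)
    then obtain u where u: "u \<in> V" "norm u < real n" "dist (f u) (y0 + y) < d/2"
      using d unfolding D_def closure_approachable by (auto dest!: spec[of _ "d/2"])
    have "y0 \<in> D n" using U by auto
    then obtain v where v: "v \<in> V" "norm v < real n" "dist (f v) y0 < d/2"
      using d unfolding D_def closure_approachable by (auto dest!: spec[of _ "d/2"])
    have "norm (f (u - v) - y) = norm ((f u - (y0 + y)) - (f v - y0))"
      by (simp add: f.diff algebra_simps)
    also have "\<dots> \<le> norm (f u - (y0 + y)) + norm (f v - y0)" by (rule norm_triangle_ineq4)
    also have "\<dots> \<le> d" using u v by (simp add: dist_norm)
    finally have "norm (f (u - v) - y) \<le> d" .
    moreover have "norm (u - v) \<le> 2 * real n"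
      using norm_triangle_ineq4[of u v] u v by simp
    ultimately show ?thesis using u v V by (intro bexI[of _ "u - v"]) (auto simp: subspace_diff)
  qed
  show ?thesis
  proof (intro exI[of _ "4 * real n / r"] conjI ballI)
    show "4 * real n / r \<ge> 0" using r by simp
    fix y assume y: "y \<in> f ` V"
    show "\<exists>x\<in>V. norm x \<le> 4 * real n / r * norm y \<and> norm (f x - y) \<le> norm y / 2"
    proof (cases "y = 0")
      case True
      then show ?thesis using V subspace_0 by (intro bexI[of _ 0]) (auto simp: f.zero)
    next
      case False
      \<comment> \<open>Scaling by \<open>t\<close> gives \<open>y\<close> the norm
        \<open>r / 2\<close>, within reach of \<open>small\<close>; an error of \<open>r / 4\<close>
        becomes \<open>norm y / 2\<close> after scaling back.\<close>
      define t where "t = r / (2 * norm y)"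
      have t: "t > 0" using False r by (simp add: t_def)
      have "norm (t *\<^sub>R y) < r" using False r by (simp add: t_def)
      moreover have "t *\<^sub>R y \<in> f ` V" using y fV by (simp add: subspace_scale)
      moreover have "r / 4 > 0" using r by simp
      ultimately obtain x where x: "x \<in> V" "norm x \<le> 2 * real n" "norm (f x - t *\<^sub>R y) \<le> r / 4"
        using small[of "t *\<^sub>R y" "r / 4"] by blast
      have "norm (x /\<^sub>R t) \<le> 4 * real n / r * norm y"
        using x(2) False r by (simp add: t_def field_simps)
      moreover have "f (x /\<^sub>R t) - y = (f x - t *\<^sub>R y) /\<^sub>R t"
        using t by (simp add: f.scaleR algebra_simps)
      then have "norm (f (x /\<^sub>R t) - y) = norm (f x - t *\<^sub>R y) / t"
        using t by (simp add: divide_inverse mult.commute)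
      moreover have "\<dots> \<le> (r / 4) / t" by (intro divide_right_mono x(3)) (use t in simp)
      moreover have "(r / 4) / t = norm y / 2" using r False by (simp add: t_def)
      ultimately show ?thesis using x(1) V
        by (intro bexI[of _ "x /\<^sub>R t"]) (auto simp: subspace_scale)
    qed
  qed
qed

text \<open>Successive correction: the residuals at least halve, so the corrections form an
  absolutely convergent series in \<open>V\<close> whose sum is an exact solution. The geometric
  series doubles the constant.\<close>

lemma open_mapping_closed_subspace:
  fixes f :: "'a::banach \<Rightarrow> 'b::banach"
  assumes f: "bounded_linear f" and V: "subspace V" "closed V" and R: "closed (f ` V)"
  shows "\<exists>C\<ge>0. \<forall>y\<in>f ` V. \<exists>x\<in>V. f x = y \<and> norm x \<le> C * norm y"
proof -
  interpret f: bounded_linear f by fact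
  obtain C where C: "C \<ge> 0"
    "\<forall>y\<in>f ` V. \<exists>x\<in>V. norm x \<le> C * norm y \<and> norm (f x - y) \<le> norm y / 2"
    using open_mapping_closed_subspace_approx[OF f V(1) R] by blast
  then obtain g where g: "\<And>y. y \<in> f ` V \<Longrightarrow> g y \<in> V"
     "\<And>y. y \<in> f ` V \<Longrightarrow> norm (g y) \<le> C * norm y"
     "\<And>y. y \<in> f ` V \<Longrightarrow> norm (f (g y) - y) \<le> norm y / 2" by metis
  have fV: "subspace (f ` V)"
    using V(1) by (rule linear_subspace_image[OF f.linear])
  have "\<exists>x\<in>V. f x = y \<and> norm x \<le> (2 * C) * norm y" if y: "y \<in> f ` V" for y
  proof -
    \<comment> \<open>\<open>res k\<close> is the part of \<open>y\<close> still unsolved after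
      \<open>k\<close> corrections.\<close>
    define res where "res = rec_nat y (\<lambda>_ r. r - f (g r))"
    have res0: "res 0 = y" and resS: "\<And>k. res (Suc k) = res k - f (g (res k))"
      by (simp_all add: res_def)
    have resV: "res k \<in> f ` V" for k
      by (induction k) (auto simp: res0 resS y intro!: subspace_diff[OF fV] g(1))
    have resn: "norm (res k) \<le> norm y * (1/2)^k" for k
    proof (induction k)
      case (Suc k)
      have "norm (res (Suc k)) \<le> norm (res k) / 2"
        using g(3)[OF resV[of k]] by (simp add: resS norm_minus_commute)
      then show ?case using Suc by simp
    qed (simp add: res0)
    define x where "x k = g (res k)" for k
    have xn: "norm (x k) \<le> (C * norm y) * (1/2)^k" for k
      using g(2)[OF resV[of k]] mult_left_mono[OF resn[of k] C(1)] by (simp add: x_def)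
    have sg: "summable (\<lambda>k. (C * norm y) * (1/2)^k)" by (intro summable_mult summable_geometric) simp
    have sm: "summable (\<lambda>k. norm (x k))" by (rule summable_comparison_test'[OF sg]) (simp add: xn)
    have sx: "summable x" using sm by (rule summable_norm_cancel)
    have "norm (suminf x) \<le> (\<Sum>k. norm (x k))" by (rule summable_norm[OF sm])
    also have "\<dots> \<le> (\<Sum>k. (C * norm y) * (1/2)^k)" by (rule suminf_le[OF xn sm sg])
    also have "\<dots> = (C * norm y) * (\<Sum>k. (1/2)^k)" by (rule suminf_mult) (simp add: summable_geometric)
    also have "\<dots> = 2 * C * norm y" by (subst suminf_geometric) auto
    finally have nx: "norm (suminf x) \<le> 2 * C * norm y" .
    have "(\<lambda>n. \<Sum>k<n. x k) \<longlonglongrightarrow> suminf x" by (rule summable_LIMSEQ[OF sx])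
    moreover have "\<And>n. (\<Sum>k<n. x k) \<in> V"
      using V(1) g(1)[OF resV] by (auto simp: x_def intro: subspace_sum)
    ultimately have xV: "suminf x \<in> V"
      using closed_sequentially[OF V(2)] by metis
    have part: "f (\<Sum>k<n. x k) = y - res n" for n
      by (induction n) (auto simp: f.zero f.add res0 resS x_def)
    have "(\<lambda>n. norm y * (1/2)^n) \<longlonglongrightarrow> norm y * 0"
      by (intro tendsto_mult tendsto_const LIMSEQ_power_zero) simp
    then have "(\<lambda>n. norm y * (1/2)^n) \<longlonglongrightarrow> 0" by simp
    then have "res \<longlonglongrightarrow> 0"
      by (rule Lim_null_comparison[rotated]) (rule always_eventually, use resn in blast)
    then have "(\<lambda>n. y - res n) \<longlonglongrightarrow> y - 0" by (intro tendsto_intros)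
    moreover have "(\<lambda>n. f (\<Sum>k<n. x k)) \<longlonglongrightarrow> f (suminf x)"
      using summable_LIMSEQ[OF sx] by (rule f.tendsto)
    ultimately have "f (suminf x) = y - 0" unfolding part by (rule LIMSEQ_unique[rotated])
    then have "f (suminf x) = y" by simp
    then show ?thesis using xV nx by blast
  qed
  then show ?thesis using C(1) by (intro exI[of _ "2 * C"]) auto
qed

text \<open>The open mapping theorem for the first projection of the graph.\<close>

lemma closed_graph_imp_bounded_linear:
  fixes f :: "'a::banach \<Rightarrow> 'b::banach"
  assumes f: "linear f" and cl: "closed {(x, f x) | x. True}"
  shows "bounded_linear f"
proof -
  let ?V = "{(x, f x) | x. True}"
  have "subspace ?V"
    by (rule subspaceI) (auto simp: linear_0[OF f] linear_add[OF f] linear_scale[OF f] zero_prod_def)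
  moreover have im: "fst ` ?V = UNIV" by (auto simp: image_iff)
  ultimately obtain C where C: "\<forall>y\<in>fst ` ?V. \<exists>x\<in>?V. fst x = y \<and> norm x \<le> C * norm y"
    using open_mapping_closed_subspace[OF bounded_linear_fst, of ?V] cl by auto
  have "norm (f x) \<le> norm x * C" for x
  proof -
    have "norm (x, f x) \<le> C * norm x" using C im by force
    then show ?thesis using norm_snd_le[of "f x" x] by (simp add: mult.commute)
  qed
  then show ?thesis using f by (intro bounded_linear_intro[where K = C]) (auto simp: linear_add linear_scale)
qed

section \<open>Hilbert spaces inside a Banach space\<close>

text \<open>
  The form is sesquilinear on the whole Banach space but induces its norm only on the closed subspace
  \<open>G\<close>. This covers both \<open>H\<close> itself and the Hilbert space \<open>eE\<close> inside a Hilbert module \<open>E\<close>.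
\<close>

locale complex_ip_subspace =
  fixes sc :: "complex \<Rightarrow> 'a::banach \<Rightarrow> 'a" and ip :: "'a \<Rightarrow> 'a \<Rightarrow> complex" and G :: "'a set"
  assumes vs: "Vector_Spaces.vector_space sc"
    and scaleR_sc: "scaleR r x = sc (complex_of_real r) x"
    and ip_add: "ip (x + y) z = ip x z + ip y z"
    and ip_sc: "ip (sc c x) y = c * ip x y"
    and ip_cnj: "ip x y = cnj (ip y x)"
    and G_zero: "0 \<in> G"
    and G_add: "x \<in> G \<Longrightarrow> y \<in> G \<Longrightarrow> x + y \<in> G"
    and G_sc: "x \<in> G \<Longrightarrow> sc c x \<in> G"
    and G_closed: "closed G"
    and G_norm: "x \<in> G \<Longrightarrow> norm x = sqrt (Re (ip x x))"
begin

sublocale vs: vector_space sc by (rule vs)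

lemma ip_add_right: "ip x (y + z) = ip x y + ip x z"
  by (metis ip_add ip_cnj complex_cnj_add)

lemma ip_sc_right: "ip x (sc c y) = cnj c * ip x y"
  by (metis ip_sc ip_cnj complex_cnj_mult)

lemma ip_zero: "ip 0 x = 0" "ip x 0 = 0"
  using ip_sc[of 0 0 x] ip_sc_right[of x 0 0] by simp_all

lemma ip_minus: "ip (- x) y = - ip x y" "ip x (- y) = - ip x y"
  using ip_sc[of "-1" x y] ip_sc_right[of x "-1" y] by simp_all

lemma ip_diff: "ip (x - y) z = ip x z - ip y z" "ip x (y - z) = ip x y - ip x z"
  using ip_add[of x "- y" z] ip_add_right[of x y "- z"] by (simp_all add: ip_minus)

lemma ip_sum: "ip (\<Sum>i\<in>I. f i) y = (\<Sum>i\<in>I. ip (f i) y)"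
  by (induction I rule: infinite_finite_induct) (simp_all add: ip_zero ip_add)

lemma ip_sum_right: "ip y (\<Sum>i\<in>I. f i) = (\<Sum>i\<in>I. ip y (f i))"
  by (induction I rule: infinite_finite_induct) (simp_all add: ip_zero ip_add_right)

lemma G_minus: "x \<in> G \<Longrightarrow> - x \<in> G"
  using G_sc[of x "-1"] by simp

lemma G_diff: "x \<in> G \<Longrightarrow> y \<in> G \<Longrightarrow> x - y \<in> G"
  using G_add[of x "- y"] G_minus[of y] by simp

lemma G_norm_sq: "x \<in> G \<Longrightarrow> (norm x)\<^sup>2 = Re (ip x x)"
  using G_norm[of x] norm_ge_zero[of x] by simp

lemma G_ip_self:
  assumes "x \<in> G"
  shows "ip x x = complex_of_real ((norm x)\<^sup>2)"
proof -
  have "Im (ip x x) = 0" using arg_cong[OF ip_cnj[of x x], of Im] by simp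
  then show ?thesis using G_norm_sq[OF assms] by (simp add: complex_eq_iff)
qed

text \<open>The subtracted vector is the projection of \<open>z\<close> onto the line of
  \<open>w\<close>. The identity gives Cauchy-Schwarz by positivity, and the orthogonality of
  minimal distances by comparison.\<close>

lemma norm_sq_diff_projection:
  assumes "z \<in> G" "w \<in> G" "w \<noteq> 0"
  shows "(norm (z - sc (ip z w / complex_of_real ((norm w)\<^sup>2)) w))\<^sup>2
           = (norm z)\<^sup>2 - (cmod (ip z w))\<^sup>2 / (norm w)\<^sup>2"
proof -
  let ?n = "complex_of_real ((norm w)\<^sup>2)"
  let ?c = "ip z w / ?n"
  have n: "?n \<noteq> 0" using assms by simp
  have "ip (z - sc ?c w) (z - sc ?c w) =
      ip z z - cnj ?c * ip z w - ?c * ip w z + ?c * (cnj ?c * ip w w)"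
    by (simp add: ip_diff ip_sc ip_sc_right algebra_simps)
  also have "ip w w = ?n" by (rule G_ip_self) fact
  also have "ip w z = cnj (ip z w)" by (rule ip_cnj)
  also have "cnj ?c = cnj (ip z w) / ?n" by simp
  also have "ip z z - cnj (ip z w) / ?n * ip z w - ?c * cnj (ip z w) + ?c * (cnj (ip z w) / ?n * ?n)
      = ip z z - (ip z w * cnj (ip z w)) / ?n"
    using n by (simp add: field_simps)
  also have "\<dots> = complex_of_real ((norm z)\<^sup>2 - (cmod (ip z w))\<^sup>2 / (norm w)\<^sup>2)"
    using G_ip_self[OF assms(1)] by (simp add: complex_norm_square[symmetric])
  finally have e: "ip (z - sc ?c w) (z - sc ?c w)
      = complex_of_real ((norm z)\<^sup>2 - (cmod (ip z w))\<^sup>2 / (norm w)\<^sup>2)" .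
  have "(norm (z - sc ?c w))\<^sup>2 = Re (ip (z - sc ?c w) (z - sc ?c w))"
    by (intro G_norm_sq G_diff G_sc assms)
  then show ?thesis unfolding e Re_complex_of_real .
qed

lemma cauchy_schwarz:
  assumes "x \<in> G" "y \<in> G"
  shows "cmod (ip x y) \<le> norm x * norm y"
proof (cases "y = 0")
  case False
  have "0 \<le> (norm x)\<^sup>2 - (cmod (ip x y))\<^sup>2 / (norm y)\<^sup>2"
    using norm_sq_diff_projection[OF assms False] zero_le_power2 by metis
  then have "(cmod (ip x y))\<^sup>2 \<le> (norm x * norm y)\<^sup>2"
    using False by (simp add: field_simps power_mult_distrib)
  then show ?thesis by (rule power2_le_imp_le) simp
qed (simp add: ip_zero)

lemma G_norm_sc:
  assumes "x \<in> G"
  shows "norm (sc c x) = cmod c * norm x"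
proof -
  have "complex_of_real ((norm (sc c x))\<^sup>2) = ip (sc c x) (sc c x)"
    using G_ip_self[OF G_sc[OF assms]] by simp
  also have "\<dots> = (c * cnj c) * ip x x" by (simp add: ip_sc ip_sc_right)
  also have "\<dots> = complex_of_real ((cmod c * norm x)\<^sup>2)"
    using G_ip_self[OF assms] by (simp add: complex_norm_square[symmetric] power_mult_distrib)
  finally have "(norm (sc c x))\<^sup>2 = (cmod c * norm x)\<^sup>2" using of_real_eq_iff by blast
  then show ?thesis by (simp add: power2_eq_iff_nonneg)
qed

lemma parallelogram:
  assumes "x \<in> G" "y \<in> G"
  shows "(norm (x + y))\<^sup>2 + (norm (x - y))\<^sup>2 = 2 * (norm x)\<^sup>2 + 2 * (norm y)\<^sup>2"
  using assms by (simp add: G_norm_sq G_add G_diff ip_add ip_add_right ip_diff)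

text \<open>A sequence in \<open>W\<close> minimising the distance to \<open>x\<close> is Cauchy by
  the parallelogram law, and minimality at its limit forces orthogonality to
  \<open>W\<close>.\<close>

lemma orthogonal_projection_exists:
  assumes W: "W \<subseteq> G" "closed W" "0 \<in> W" "\<And>u v. u \<in> W \<Longrightarrow> v \<in> W \<Longrightarrow> u + v \<in> W"
      "\<And>c u. u \<in> W \<Longrightarrow> sc c u \<in> W"
    and x: "x \<in> G"
  shows "\<exists>u\<in>W. \<forall>w\<in>W. ip (x - u) w = 0"
proof -
  define D where "D = (INF w\<in>W. (norm (x - w))\<^sup>2)"
  have bdd: "bdd_below ((\<lambda>w. (norm (x - w))\<^sup>2) ` W)" by (rule bdd_belowI[of _ 0]) auto
  have D: "D \<le> (norm (x - w))\<^sup>2" if "w \<in> W" for w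
    unfolding D_def by (rule cINF_lower[OF bdd that])
  have "\<exists>w\<in>W. (norm (x - w))\<^sup>2 < D + 1 / real (Suc n)" for n
  proof -
    have "D < D + 1 / real (Suc n)" by simp
    then show ?thesis using W(3) bdd unfolding D_def by (subst (asm) cINF_less_iff) auto
  qed
  then obtain w where w: "\<And>n. w n \<in> W" "\<And>n. (norm (x - w n))\<^sup>2 < D + 1 / real (Suc n)" by metis
  \<comment> \<open>The midpoint \<open>?v\<close> of \<open>w m\<close> and \<open>w n\<close> lies
    in \<open>W\<close>, so its squared distance to \<open>x\<close> is at least \<open>D\<close>;
    the parallelogram law leaves only the two excesses over \<open>D\<close>.\<close>
  have close: "(norm (w m - w n))\<^sup>2 \<le> 2 / real (Suc m) + 2 / real (Suc n)" for m n
  proof -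
    let ?v = "sc (1/2) (w m + w n)"
    have v: "?v \<in> W" using W w by auto
    have "sc 2 (x - ?v) = sc 2 x - sc 1 (w m + w n)"
      by (simp only: vs.scale_right_diff_distrib vs.scale_scale) simp
    also have "sc 2 x = x + x"
      using vs.scale_left_distrib[of 1 1 x] by simp
    finally have "(x - w m) + (x - w n) = sc 2 (x - ?v)" by simp
    then have "norm ((x - w m) + (x - w n)) = 2 * norm (x - ?v)"
      using G_norm_sc[of "x - ?v" 2] v W(1) x by (auto simp: G_diff)
    moreover have "norm ((x - w m) - (x - w n)) = norm (w m - w n)"
      by (simp add: norm_minus_commute)
    moreover have "(norm ((x - w m) + (x - w n)))\<^sup>2 + (norm ((x - w m) - (x - w n)))\<^sup>2
        = 2 * (norm (x - w m))\<^sup>2 + 2 * (norm (x - w n))\<^sup>2"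
      using W(1) w(1) x by (intro parallelogram G_diff) auto
    ultimately have "4 * (norm (x - ?v))\<^sup>2 + (norm (w m - w n))\<^sup>2
        = 2 * (norm (x - w m))\<^sup>2 + 2 * (norm (x - w n))\<^sup>2" by (simp add: power_mult_distrib)
    then show ?thesis using D[OF v] w(2)[of m] w(2)[of n] by linarith
  qed
  have "Cauchy w"
  proof (rule metric_CauchyI)
    fix e :: real assume e: "e > 0"
    then obtain N where N: "1 / real (Suc N) < e\<^sup>2 / 4"
      using nat_approx_posE[of "e\<^sup>2/4"] by auto
    show "\<exists>M. \<forall>m\<ge>M. \<forall>n\<ge>M. dist (w m) (w n) < e"
    proof (intro exI[of _ N] allI impI)
      fix m n assume "N \<le> m" "N \<le> n"
      then have "1 / real (Suc m) \<le> 1 / real (Suc N)" "1 / real (Suc n) \<le> 1 / real (Suc N)"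
        by (auto simp: frac_le)
      then have "(norm (w m - w n))\<^sup>2 < e\<^sup>2" using close[of m n] N by linarith
      then show "dist (w m) (w n) < e" using e by (simp add: dist_norm power_less_imp_less_base)
    qed
  qed
  then obtain u where u: "w \<longlonglongrightarrow> u" using Cauchy_convergent convergent_def by blast
  have uW: "u \<in> W" using closed_sequentially[OF W(2), of w u] w u by blast
  have "(\<lambda>n. (norm (x - w n))\<^sup>2) \<longlonglongrightarrow> (norm (x - u))\<^sup>2" using u by (intro tendsto_intros)
  moreover have "(\<lambda>n. D + 1 / real (Suc n)) \<longlonglongrightarrow> D + 0"
    by (intro tendsto_add tendsto_const LIMSEQ_Suc[OF lim_1_over_n])
  ultimately have "(norm (x - u))\<^sup>2 \<le> D + 0"
    by (rule LIMSEQ_le) (use w(2) less_imp_le in blast)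
  then have min: "(norm (x - u))\<^sup>2 \<le> (norm (x - v))\<^sup>2" if "v \<in> W" for v using D[OF that] by linarith
  have "ip (x - u) v = 0" if v: "v \<in> W" for v
  proof (cases "v = 0")
    case False
    \<comment> \<open>Shifting \<open>u\<close> by \<open>sc ?c v\<close> would lower the distance
      strictly unless the inner product vanishes.\<close>
    let ?c = "ip (x - u) v / complex_of_real ((norm v)\<^sup>2)"
    have "(norm (x - u))\<^sup>2 \<le> (norm (x - (u + sc ?c v)))\<^sup>2" by (rule min) (intro W uW v)
    also have "x - (u + sc ?c v) = (x - u) - sc ?c v" by simp
    also have "(norm \<dots>)\<^sup>2 = (norm (x - u))\<^sup>2 - (cmod (ip (x - u) v))\<^sup>2 / (norm v)\<^sup>2"
      by (rule norm_sq_diff_projection) (use W(1) v uW x False in \<open>auto simp: G_diff\<close>)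
    finally have "(cmod (ip (x - u) v))\<^sup>2 / (norm v)\<^sup>2 \<le> 0" by simp
    then show ?thesis using False by (simp add: divide_le_0_iff)
  qed (simp add: ip_zero)
  then show ?thesis using uW by blast
qed

text \<open>The representing vector is a multiple of the component \<open>z\<close> of some
  \<open>x\<close> with \<open>f x \<noteq> 0\<close> that is orthogonal to the kernel of
  \<open>f\<close> in \<open>G\<close>.\<close>

lemma riesz_representation:
  assumes add: "\<And>x y. f (x + y) = f x + f y" and scale: "\<And>c x. f (sc c x) = c * f x"
    and cont: "continuous_on G f"
  shows "\<exists>z\<in>G. \<forall>y\<in>G. f y = ip y z"
proof (cases "\<forall>y\<in>G. f y = 0")
  case True
  then show ?thesis by (intro bexI[OF _ G_zero]) (simp add: ip_zero)
next
  case False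
  then obtain x where x: "x \<in> G" "f x \<noteq> 0" by blast
  have f0: "f 0 = 0" using scale[of 0 0] by simp
  let ?W = "G \<inter> f -` {0}"
  have "closed ?W" by (rule continuous_closed_preimage[OF cont G_closed]) simp
  then have "\<exists>u\<in>?W. \<forall>w\<in>?W. ip (x - u) w = 0"
    by (intro orthogonal_projection_exists) (auto simp: G_zero G_add G_sc f0 add scale x)
  then obtain u where u: "u \<in> G" "f u = 0" "\<And>w. w \<in> G \<Longrightarrow> f w = 0 \<Longrightarrow> ip (x - u) w = 0" by auto
  define z where "z = x - u"
  have "f x = f z + f u" using add[of z u] by (simp add: z_def)
  then have fz: "f z \<noteq> 0" using x u by simp
  have zG: "z \<in> G" by (simp add: z_def G_diff x u)
  have z0: "z \<noteq> 0" using fz f0 by auto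
  let ?n = "complex_of_real ((norm z)\<^sup>2)"
  have "f y = ip y (sc (cnj (f z / ?n)) z)" if y: "y \<in> G" for y
  proof -
    have fd: "f (v - v') = f v - f v'" for v v' using add[of "v - v'" v'] by simp
    \<comment> \<open>The coefficient puts \<open>?w\<close> into the kernel of \<open>f\<close>, so
      \<open>z\<close> is orthogonal to it and \<open>ip y z\<close> can be read off.\<close>
    let ?w = "y - sc (f y / f z) z"
    have "ip z ?w = 0"
      using u(3)[of ?w] y zG fz by (simp add: fd scale G_diff G_sc z_def[symmetric])
    then have "ip ?w z = 0" using ip_cnj[of ?w z] by simp
    then have "ip y z = f y / f z * ?n" using G_ip_self[OF zG] by (simp add: ip_diff ip_sc)
    then show ?thesis using fz z0 by (simp add: ip_sc_right)
  qed
  then show ?thesis using G_sc[OF zG] by blast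
qed

end

section \<open>Hilbert modules over the compact operators\<close>

locale hilbert_module_over_K =
  fixes scH :: "complex \<Rightarrow> 'h::banach \<Rightarrow> 'h" and ipH :: "'h \<Rightarrow> 'h \<Rightarrow> complex"
    and scE :: "complex \<Rightarrow> 'e::banach \<Rightarrow> 'e" and act :: "('h \<Rightarrow> 'h) \<Rightarrow> 'e \<Rightarrow> 'e"
    and ipE :: "'e \<Rightarrow> 'e \<Rightarrow> ('h \<Rightarrow> 'h)"
  assumes hilbert_K_module: "hilbert_K_module scH ipH scE act ipE"
begin

abbreviation K where "K \<equiv> compact_ops scH"

lemma complex_hilbert_space_H: "complex_hilbert_space scH ipH"
  using hilbert_K_module by (simp add: hilbert_K_module_def)

sublocale H: complex_ip_subspace scH ipH UNIV
proof (rule complex_ip_subspace.intro)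
  note h = complex_hilbert_space_H[unfolded complex_hilbert_space_def]
  show "Vector_Spaces.vector_space scH" using h by blast
  show "r *\<^sub>R x = scH (complex_of_real r) x" for r x using h by blast
  show "ipH (x + y) z = ipH x z + ipH y z" for x y z using h by blast
  show "ipH (scH c x) y = c * ipH x y" for c x y using h by blast
  show "ipH x y = cnj (ipH y x)" for x y using h by blast
  show "norm x = sqrt (Re (ipH x x))" for x using h by blast
qed auto

lemma vector_space_E: "Vector_Spaces.vector_space scE"
  using hilbert_K_module by (simp add: hilbert_K_module_def)

sublocale E: vector_space scE by (rule vector_space_E)

lemma scaleR_scE: "scaleR r x = scE (complex_of_real r) x"
  using hilbert_K_module unfolding hilbert_K_module_def by (elim conjE) metis

lemma act_comp: "a \<in> K \<Longrightarrow> b \<in> K \<Longrightarrow> act (a \<circ> b) x = act a (act b x)"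
  and act_add_left: "a \<in> K \<Longrightarrow> b \<in> K \<Longrightarrow> act (\<lambda>h. a h + b h) x = act a x + act b x"
  and act_add: "a \<in> K \<Longrightarrow> act a (x + y) = act a x + act a y"
  and act_sc_left: "a \<in> K \<Longrightarrow> act (\<lambda>h. scH c (a h)) x = scE c (act a x)"
  and act_sc: "a \<in> K \<Longrightarrow> act a (scE c x) = scE c (act a x)"
  using hilbert_K_module unfolding hilbert_K_module_def by (elim conjE, metis)+

lemma ipE_in_K: "ipE x y \<in> K"
  and ipE_add: "ipE (x + y) z h = ipE x z h + ipE y z h"
  and ipE_sc: "ipE (scE c x) y h = scH c (ipE x y h)"
  and ipE_eq_adjH: "ipE x y = adjH ipH (ipE y x)"
  and ipE_self_positive: "positive_op ipH (ipE x x)"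
  and ipE_self_eq_0_iff: "ipE x x = (\<lambda>_. 0) \<longleftrightarrow> x = 0"
  and norm_E: "norm x = sqrt (onorm (ipE x x))"
  using hilbert_K_module unfolding hilbert_K_module_def by (elim conjE, metis)+

lemma ipE_act_comp: "a \<in> K \<Longrightarrow> ipE (act a x) y = a \<circ> ipE x y"
  using hilbert_K_module unfolding hilbert_K_module_def by (elim conjE) metis

lemma ipE_act: "a \<in> K \<Longrightarrow> ipE (act a x) y h = a (ipE x y h)"
  by (simp add: ipE_act_comp)

lemma K_add: "a \<in> K \<Longrightarrow> a (x + y) = a x + a y"
  and K_sc: "a \<in> K \<Longrightarrow> a (scH c x) = scH c (a x)"
  and K_bounded_linear: "a \<in> K \<Longrightarrow> bounded_linear a"
  by (auto simp: compact_ops_def Vector_Spaces.linear_iff)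

lemma K_zero: "a \<in> K \<Longrightarrow> a 0 = 0"
  by (simp add: K_bounded_linear linear_simps(3))

lemma ipH_ext: "(\<And>k. ipH x k = ipH y k) \<Longrightarrow> x = y"
  using H.G_ip_self[of "x - y"] by (simp add: H.ip_diff)

lemma ipH_ext_right: "(\<And>k. ipH k x = ipH k y) \<Longrightarrow> x = y"
  by (rule ipH_ext) (metis H.ip_cnj)

lemma norm_H_le:
  assumes "\<And>k. cmod (ipH x k) \<le> C * norm k" "C \<ge> 0"
  shows "norm x \<le> C"
proof (cases "x = 0")
  case False
  have "norm x * norm x \<le> C * norm x"
    using assms(1)[of x] H.G_ip_self[of x] by (simp add: power2_eq_square norm_mult)
  then show ?thesis using False by simp
qed (use assms in simp)

lemma H_cauchy_schwarz: "cmod (ipH x y) \<le> norm x * norm y"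
  by (rule H.cauchy_schwarz) auto

lemma norm_scH: "norm (scH c x) = cmod c * norm x"
  by (rule H.G_norm_sc) auto

lemma bounded_linear_scH: "bounded_linear (scH c)"
  by (rule bounded_linear_intro[where K = "cmod c"])
    (simp_all add: H.vs.scale_right_distrib norm_scH mult.commute H.scaleR_sc H.vs.scale_left_commute)

lemma bounded_linear_scH_left: "bounded_linear (\<lambda>c. scH c x)"
  by (rule bounded_linear_intro[where K = "norm x"])
    (simp_all add: H.vs.scale_left_distrib norm_scH H.scaleR_sc scaleR_conv_of_real)

lemma bounded_linear_ipH: "bounded_linear (\<lambda>x. ipH x y)"
  by (rule bounded_linear_intro[where K = "norm y"])
    (simp_all add: H.ip_add H.ip_sc H_cauchy_schwarz H.scaleR_sc scaleR_conv_of_real)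

text \<open>Riesz representation of the functionals \<open>\<lambda>x. ipH (a x) y\<close>.
  Existence is what turns the choice in \<open>adjH\<close> into the actual adjoint.\<close>

lemma adjoint_exists:
  assumes "a \<in> K"
  shows "\<exists>b. \<forall>x y. ipH (a x) y = ipH x (b y)"
proof -
  have "\<exists>z. \<forall>x. ipH (a x) y = ipH x z" for y
  proof -
    have "bounded_linear (\<lambda>x. ipH (a x) y)"
      using bounded_linear_compose[OF bounded_linear_ipH K_bounded_linear[OF assms]] .
    then have "continuous_on UNIV (\<lambda>x. ipH (a x) y)" by (rule linear_continuous_on)
    then show ?thesis
      using H.riesz_representation[of "\<lambda>x. ipH (a x) y"]
      by (simp add: K_add K_sc assms H.ip_add H.ip_sc)
  qed
  then show ?thesis by metis
qed

lemma ipH_adjH: "a \<in> K \<Longrightarrow> ipH (a x) y = ipH x (adjH ipH a y)"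
  unfolding adjH_def using someI_ex[OF adjoint_exists] by blast

text \<open>Pointwise form of the symmetry of the inner product; properties in the second variable
  are derived from those in the first through this rule.\<close>

lemma ipH_ipE: "ipH (ipE x y h) k = ipH h (ipE y x k)"
  using ipH_adjH[OF ipE_in_K] ipE_eq_adjH by metis

lemma adjH_eqI:
  assumes "\<And>x y. ipH (a x) y = ipH x (b y)"
  shows "adjH ipH a = b"
proof
  fix y
  have "\<forall>x y. ipH (a x) y = ipH x (adjH ipH a y)"
    unfolding adjH_def by (rule someI[of _ b]) (simp add: assms)
  then show "adjH ipH a y = b y" using assms by (intro ipH_ext_right) metis
qed

lemma ipE_add_right: "ipE x (y + z) h = ipE x y h + ipE x z h"
  by (rule ipH_ext) (simp add: ipH_ipE ipE_add H.ip_add H.ip_add_right)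

lemma ipE_sc_right: "ipE x (scE c y) h = scH (cnj c) (ipE x y h)"
  by (rule ipH_ext) (simp add: ipH_ipE ipE_sc H.ip_sc H.ip_sc_right)

lemma ipE_act_right:
  assumes "a \<in> K" "\<And>x y. ipH (a x) y = ipH x (b y)"
  shows "ipE x (act a y) h = ipE x y (b h)"
proof (rule ipH_ext)
  fix k
  have "ipH (ipE x (act a y) h) k = ipH h (a (ipE y x k))"
    using assms(1) by (simp add: ipH_ipE ipE_act)
  also have "\<dots> = cnj (ipH (a (ipE y x k)) h)" by (rule H.ip_cnj)
  also have "\<dots> = ipH (b h) (ipE y x k)" unfolding assms(2) by (rule H.ip_cnj[symmetric])
  finally show "ipH (ipE x (act a y) h) k = ipH (ipE x y (b h)) k" by (simp add: ipH_ipE)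
qed

lemma ipE_zero: "ipE 0 x h = 0" "ipE x 0 h = 0"
  using ipE_sc[of 0 0 x h] ipE_sc_right[of x 0 0 h] by simp_all

lemma ipE_minus: "ipE (- x) y h = - ipE x y h" "ipE x (- y) h = - ipE x y h"
  using ipE_sc[of "-1" x y h] ipE_sc_right[of x "-1" y h] by simp_all

lemma ipE_diff: "ipE (x - y) z h = ipE x z h - ipE y z h" "ipE x (y - z) h = ipE x y h - ipE x z h"
  using ipE_add[of x "- y" z h] ipE_add_right[of x y "- z" h] by (simp_all add: ipE_minus)

lemma ipE_sum: "ipE (\<Sum>i\<in>I. f i) y h = (\<Sum>i\<in>I. ipE (f i) y h)"
  by (induction I rule: infinite_finite_induct) (simp_all add: ipE_zero ipE_add)

lemma ipE_sum_right: "ipE y (\<Sum>i\<in>I. f i) h = (\<Sum>i\<in>I. ipE y (f i) h)"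
  by (induction I rule: infinite_finite_induct) (simp_all add: ipE_zero ipE_add_right)

lemma ipE_self_zeroD: "(\<And>h. ipE x x h = 0) \<Longrightarrow> x = 0"
  using ipE_self_eq_0_iff[of x] by auto

lemma ipE_ext:
  assumes "\<And>z h. ipE x z h = ipE y z h"
  shows "x = y"
  using ipE_self_zeroD[of "x - y"] by (simp add: ipE_diff(1) assms)

lemma norm_E_sq: "(norm x)\<^sup>2 = onorm (ipE x x)"
  using norm_E[of x] onorm_pos_le[OF K_bounded_linear[OF ipE_in_K]] by simp

lemma norm_ipE_self: "norm (ipE x x h) \<le> (norm x)\<^sup>2 * norm h"
  using onorm[OF K_bounded_linear[OF ipE_in_K]] norm_E_sq by metis

lemma norm_E_le:
  assumes "\<And>h k. cmod (ipH (ipE x x h) k) \<le> M\<^sup>2 * norm h * norm k" "M \<ge> 0"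
  shows "norm x \<le> M"
proof -
  have "norm (ipE x x h) \<le> M\<^sup>2 * norm h" for h
    by (rule norm_H_le) (use assms in auto)
  then have "(norm x)\<^sup>2 \<le> M\<^sup>2"
    unfolding norm_E_sq by (intro onorm_bound) (use assms in auto)
  then show ?thesis using assms(2) by (rule power2_le_imp_le)
qed

lemma norm_scE_le: "norm (scE c x) \<le> cmod c * norm x"
proof (rule norm_E_le)
  fix h k
  have "cmod (ipH (ipE (scE c x) (scE c x) h) k) = (cmod c)\<^sup>2 * cmod (ipH (ipE x x h) k)"
    by (simp add: ipE_sc ipE_sc_right H.ip_sc norm_mult power2_eq_square)
  also have "\<dots> \<le> (cmod c)\<^sup>2 * ((norm x)\<^sup>2 * norm h * norm k)"
    by (intro mult_left_mono order_trans[OF H_cauchy_schwarz] mult_right_mono norm_ipE_self) auto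
  finally show "cmod (ipH (ipE (scE c x) (scE c x) h) k) \<le> (cmod c * norm x)\<^sup>2 * norm h * norm k"
    by (simp add: power_mult_distrib mult.assoc)
qed simp

lemma bounded_linear_scE: "bounded_linear (scE c)"
  by (rule bounded_linear_intro[where K = "cmod c"])
    (simp_all add: E.scale_right_distrib norm_scE_le mult.commute[of _ "cmod c"] scaleR_scE E.scale_left_commute)

lemma bounded_linear_scE_left: "bounded_linear (\<lambda>c. scE c x)"
  by (rule bounded_linear_intro[where K = "norm x"])
    (simp_all add: E.scale_left_distrib norm_scE_le scaleR_scE scaleR_conv_of_real)

lemma norm_adjH_le:
  assumes "a \<in> K"
  shows "norm (adjH ipH a h) \<le> onorm a * norm h"
proof (rule norm_H_le)
  fix k
  have "cmod (ipH (adjH ipH a h) k) = cmod (ipH (a k) h)"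
    unfolding ipH_adjH[OF assms] by (subst H.ip_cnj) simp
  also have "\<dots> \<le> norm (a k) * norm h" by (rule H_cauchy_schwarz)
  also have "\<dots> \<le> (onorm a * norm k) * norm h"
    by (intro mult_right_mono onorm K_bounded_linear assms) auto
  finally show "cmod (ipH (adjH ipH a h) k) \<le> onorm a * norm h * norm k" by (simp add: mult_ac)
qed (simp add: onorm_pos_le K_bounded_linear assms)

text \<open>Since \<langle>ax, ax\<rangle> is a \<langle>x, x\<rangle> b with b the adjoint of a,
  its coefficients at \<open>h\<close>, \<open>k\<close> are those of \<langle>x, x\<rangle> at
  \<open>?b h\<close>, \<open>?b k\<close>.\<close>

lemma norm_act_le:
  assumes "a \<in> K"
  shows "norm (act a x) \<le> onorm a * norm x"
proof (rule norm_E_le)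
  let ?b = "adjH ipH a"
  have pos: "0 \<le> onorm a" by (simp add: onorm_pos_le K_bounded_linear assms)
  fix h k
  have "ipH (ipE (act a x) (act a x) h) k = ipH (ipE x x (?b h)) (?b k)"
    using assms by (simp add: ipE_act ipE_act_right[OF _ ipH_adjH] ipH_adjH)
  also have "cmod \<dots> \<le> ((norm x)\<^sup>2 * norm (?b h)) * norm (?b k)"
    by (intro order_trans[OF H_cauchy_schwarz] mult_right_mono norm_ipE_self) auto
  also have "\<dots> \<le> ((norm x)\<^sup>2 * (onorm a * norm h)) * (onorm a * norm k)"
    by (intro mult_mono norm_adjH_le assms) (auto simp: pos)
  finally show "cmod (ipH (ipE (act a x) (act a x) h) k) \<le> (onorm a * norm x)\<^sup>2 * norm h * norm k"
    by (simp add: power2_eq_square mult_ac)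
qed (simp add: onorm_pos_le K_bounded_linear assms)

lemma bounded_linear_act: "a \<in> K \<Longrightarrow> bounded_linear (act a)"
  by (rule bounded_linear_intro[where K = "onorm a"])
    (simp_all add: act_add act_sc scaleR_scE norm_act_le mult.commute)

section \<open>Rank-one operators and their action on the module\<close>

definition rank_one :: "'h \<Rightarrow> 'h \<Rightarrow> 'h \<Rightarrow> 'h" where
  "rank_one g k = (\<lambda>h. scH (ipH h k) g)"

lemma norm_rank_one_le: "norm (rank_one g k h) \<le> (norm g * norm k) * norm h"
  using mult_right_mono[OF H_cauchy_schwarz[of h k], of "norm g"]
  by (simp add: rank_one_def norm_scH mult_ac)

lemma onorm_rank_one_le: "onorm (rank_one g k) \<le> norm g * norm k"
  by (rule onorm_bound) (simp_all add: norm_rank_one_le)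

lemma rank_one_in_K: "rank_one g k \<in> K"
proof -
  have "Vector_Spaces.linear scH scH (rank_one g k)"
    unfolding Vector_Spaces.linear_iff
    by (simp add: H.vs rank_one_def H.ip_add H.ip_sc H.vs.scale_left_distrib)
  moreover have "bounded_linear (rank_one g k)"
    unfolding rank_one_def
    by (rule bounded_linear_compose[OF bounded_linear_scH_left bounded_linear_ipH])
  moreover have "compact (closure (rank_one g k ` ball 0 1))"
  proof -
    let ?C = "(\<lambda>c. scH c g) ` cball 0 (norm k)"
    have c: "compact ?C"
      by (intro compact_continuous_image linear_continuous_on bounded_linear_scH_left) simp
    have "rank_one g k ` ball 0 1 \<subseteq> ?C"
    proof
      fix y assume "y \<in> rank_one g k ` ball 0 1"
      then obtain h where h: "norm h < 1" "y = rank_one g k h" by auto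
      have "cmod (ipH h k) \<le> norm k"
        using H_cauchy_schwarz[of h k] h(1) mult_right_mono[of "norm h" 1 "norm k"] by simp
      then show "y \<in> ?C" using h(2) by (auto simp: rank_one_def)
    qed
    then have "closure (rank_one g k ` ball 0 1) \<subseteq> ?C"
      using c by (intro closure_minimal compact_imp_closed)
    then show ?thesis using c compact_closure bounded_subset compact_Int_closed
      by (metis closed_closure inf.absorb_iff2)
  qed
  ultimately show ?thesis by (simp add: compact_ops_def)
qed

lemma ipH_rank_one: "ipH (rank_one g k x) y = ipH x (rank_one k g y)"
proof -
  have "ipH x (rank_one k g y) = cnj (ipH y g) * ipH x k" by (simp add: rank_one_def H.ip_sc_right)
  also have "cnj (ipH y g) = ipH g y" by (rule H.ip_cnj[symmetric])
  finally show ?thesis by (simp add: rank_one_def H.ip_sc)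
qed

lemma ipE_act_rank_one_right: "ipE x (act (rank_one g k) y) h = ipE x y (rank_one k g h)"
  by (rule ipE_act_right[OF rank_one_in_K ipH_rank_one])

lemma act_comp_rank_one: "a \<in> K \<Longrightarrow> act a (act (rank_one g k) x) = act (rank_one (a g) k) x"
  by (simp only: act_comp[OF _ rank_one_in_K, symmetric]) (simp add: comp_def rank_one_def K_sc)

lemma act_rank_one_rank_one:
  "act (rank_one g k) (act (rank_one g' k') x) = scE (ipH g' k) (act (rank_one g k') x)"
proof -
  have "act (rank_one (rank_one g k g') k') x = act (\<lambda>h. scH (ipH g' k) (rank_one g k' h)) x"
    by (simp add: rank_one_def mult.commute)
  then show ?thesis by (simp add: act_comp_rank_one rank_one_in_K act_sc_left)
qed

lemma act_diff: "a \<in> K \<Longrightarrow> act a (x - y) = act a x - act a y"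
  using act_add[of a "x - y" y] by simp

lemma act_zero: "a \<in> K \<Longrightarrow> act a 0 = 0"
  using act_add[of a 0 0] by simp

lemma act_sum: "a \<in> K \<Longrightarrow> act a (\<Sum>i\<in>I. f i) = (\<Sum>i\<in>I. act a (f i))"
  by (induction I rule: infinite_finite_induct) (simp_all add: act_zero act_add)

text \<open>A continuous map sends the compact closure of the image of the ball to a compact set.
  Allowing bounded \<open>d\<close> covers scalar multiplication, which is not compact on an
  infinite-dimensional space.\<close>

lemma K_bounded_linear_comp:
  assumes "a \<in> K" "bounded_linear d" "\<And>c x. d (scH c x) = scH c (d x)"
  shows "d \<circ> a \<in> K"
proof -
  have d: "d (x + y) = d x + d y" for x y
    using assms(2) by (simp add: linear_simps(1))
  have "Vector_Spaces.linear scH scH (d \<circ> a)"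
    unfolding Vector_Spaces.linear_iff
    using assms by (simp add: H.vs K_add K_sc d)
  moreover have "bounded_linear (d \<circ> a)"
    using bounded_linear_compose[OF assms(2) K_bounded_linear[OF assms(1)]] by (simp add: comp_def)
  moreover have "compact (closure ((d \<circ> a) ` ball 0 1))"
  proof -
    have "compact (closure (a ` ball 0 1))" using assms(1) by (simp add: compact_ops_def)
    then have c: "compact (d ` closure (a ` ball 0 1))"
      by (intro compact_continuous_image linear_continuous_on assms(2))
    have "(d \<circ> a) ` ball 0 1 \<subseteq> d ` closure (a ` ball 0 1)"
      using closure_subset by fastforce
    then have "closure ((d \<circ> a) ` ball 0 1) \<subseteq> d ` closure (a ` ball 0 1)"
      using c by (intro closure_minimal compact_imp_closed)
    then show ?thesis using c by (metis closed_closure inf.absorb_iff2 compact_Int_closed)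
  qed
  ultimately show ?thesis by (simp add: compact_ops_def)
qed

lemma K_comp: "a \<in> K \<Longrightarrow> d \<in> K \<Longrightarrow> d \<circ> a \<in> K"
  by (rule K_bounded_linear_comp) (simp_all add: K_bounded_linear K_sc)

lemma K_scale: "a \<in> K \<Longrightarrow> (\<lambda>h. scH c (a h)) \<in> K"
  using K_bounded_linear_comp[OF _ bounded_linear_scH, of a c]
  by (simp add: comp_def H.vs.scale_left_commute)

section \<open>Finite orthonormal sets and finite-rank approximation\<close>

definition finite_orthonormal :: "'h set \<Rightarrow> bool" where
  "finite_orthonormal B \<longleftrightarrow> finite B \<and> (\<forall>g\<in>B. ipH g g = 1) \<and>
     (\<forall>g\<in>B. \<forall>g'\<in>B. g \<noteq> g' \<longrightarrow> ipH g g' = 0)"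

lemma finite_orthonormal_ip_sum:
  assumes B: "finite_orthonormal B" and g: "g \<in> B"
  shows "ipH (\<Sum>g'\<in>B. rank_one g' g' v) g = ipH v g"
proof -
  have "ipH (\<Sum>g'\<in>B. rank_one g' g' v) g = (\<Sum>g'\<in>B. ipH v g' * ipH g' g)"
    by (simp add: H.ip_sum rank_one_def H.ip_sc)
  also have "\<dots> = (\<Sum>g'\<in>B. if g' = g then ipH v g else 0)"
    using B g by (intro sum.cong) (auto simp: finite_orthonormal_def)
  also have "\<dots> = ipH v g" using B g by (simp add: finite_orthonormal_def)
  finally show ?thesis .
qed

text \<open>Induction on \<open>A\<close>: the normalised residual of the new vector is added to
  \<open>B\<close>, or nothing if the residual is zero. That \<open>A\<close> lies in the span of
  \<open>B\<close> is expressed as being fixed by the projection.\<close>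

lemma gram_schmidt:
  assumes "finite A"
  shows "\<exists>B. finite_orthonormal B \<and> (\<forall>a\<in>A. (\<Sum>g\<in>B. rank_one g g a) = a)"
  using assms
proof (induction A rule: finite_induct)
  case (insert a A)
  then obtain B where B: "finite_orthonormal B"
    and BA: "\<forall>a\<in>A. (\<Sum>g\<in>B. rank_one g g a) = a" by blast
  have finB: "finite B" using B by (simp add: finite_orthonormal_def)
  define P where "P v = (\<Sum>g\<in>B. rank_one g g v)" for v
  define r where "r = a - P a"
  show ?case
  proof (cases "r = 0")
    case True
    then show ?thesis using B BA by (intro exI[of _ B]) (auto simp: r_def P_def)
  next
    case False
    have rB: "ipH r g = 0" if "g \<in> B" for g
      using finite_orthonormal_ip_sum[OF B that] by (simp add: r_def P_def H.ip_diff)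
    define n where "n = complex_of_real (norm r)"
    have n: "n \<noteq> 0" "cnj n = n" using False by (auto simp: n_def)
    define g where "g = scH (1 / n) r"
    have rr: "ipH r r = n * n" using H.G_ip_self[of r] by (simp add: n_def power2_eq_square)
    have gg: "ipH g g = 1" using n by (simp add: g_def H.ip_sc H.ip_sc_right rr)
    have gB: "ipH g g' = 0" "ipH g' g = 0" if "g' \<in> B" for g'
    proof -
      show 1: "ipH g g' = 0" using rB[OF that] by (simp add: g_def H.ip_sc)
      show "ipH g' g = 0" using 1 H.ip_cnj[of g' g] by simp
    qed
    have gnB: "g \<notin> B" using gB gg by force
    have Pg: "ipH (P v) g = 0" for v
      by (simp add: P_def H.ip_sum rank_one_def H.ip_sc gB)
    have "(\<Sum>g'\<in>insert g B. rank_one g' g' v) = P v + scH (ipH v g) g" for v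
      using finB gnB by (simp add: P_def rank_one_def)
    moreover have "P v + scH (ipH v g) g = v" if v: "v \<in> insert a A" for v
    proof (cases "v \<in> A")
      case True
      then have "P v = v" using BA by (simp add: P_def)
      then show ?thesis using Pg[of v] by simp
    next
      case False
      then have v: "v = P a + r" "v = a" using v by (auto simp: r_def)
      have "ipH r g = n" using n by (simp add: g_def H.ip_sc_right rr)
      then have "ipH v g = n" unfolding v(1) H.ip_add Pg by simp
      then have "scH (ipH v g) g = r" using n by (simp add: g_def)
      then show ?thesis using v by simp
    qed
    moreover have "finite_orthonormal (insert g B)"
      using B gB gg by (auto simp: finite_orthonormal_def)
    ultimately show ?thesis by (intro exI[of _ "insert g B"]) auto
  qed
qed (auto simp: finite_orthonormal_def)

text \<open>With \<open>P\<close> the projection of \<open>v\<close>, the vector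
  \<open>v - P\<close> is orthogonal to \<open>P\<close>, so its squared norm is the inner product
  with \<open>v\<close>; Cauchy-Schwarz then applies.\<close>

lemma norm_diff_orthonormal_projection_le:
  assumes B: "finite_orthonormal B"
  shows "norm (v - (\<Sum>g\<in>B. rank_one g g v)) \<le> norm v"
proof -
  define P where "P = (\<Sum>g\<in>B. rank_one g g v)"
  have vB: "ipH (v - P) g = 0" if "g \<in> B" for g
    using finite_orthonormal_ip_sum[OF B that] by (simp add: P_def H.ip_diff)
  have "ipH (v - P) P = 0"
    by (subst (2) P_def) (simp add: H.ip_sum_right rank_one_def H.ip_sc_right vB)
  then have "ipH (v - P) (v - P) = ipH (v - P) v" by (subst H.ip_diff(2)) simp
  then have "(norm (v - P))\<^sup>2 = cmod (ipH (v - P) v)"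
    using H.G_ip_self[of "v - P"] by (metis UNIV_I norm_of_real abs_power2)
  then have "norm (v - P) * norm (v - P) \<le> norm v * norm (v - P)"
    using H_cauchy_schwarz[of "v - P" v] by (simp add: power2_eq_square mult.commute)
  then show ?thesis unfolding P_def[symmetric] by (cases "v - P = 0") auto
qed

lemma rank_one_diff: "rank_one g k (v - w) = rank_one g k v - rank_one g k w"
  by (simp add: rank_one_def H.ip_diff H.vs.scale_left_diff_distrib)

text \<open>
  With \<open>p\<close> the projection onto the span of a finite net of the image of the unit ball under
  \<open>a = \<langle>x, x\<rangle>\<close>, the norm of \<open>\<langle>x - px, x - px\<rangle> = (1 - p) a (1 - p)\<close> is small.
\<close>

lemma approx_act_finite_rank:
  assumes "\<epsilon> > 0"
  shows "\<exists>B. finite B \<and> norm (x - (\<Sum>g\<in>B. act (rank_one g g) x)) < \<epsilon>"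
proof -
  \<comment> \<open>Chosen so that \<open>2 * \<delta>\<close> is the square of
    \<open>\<epsilon> / 2\<close>, as the final norm estimate requires.\<close>
  define \<delta> where "\<delta> = (\<epsilon>/2)\<^sup>2 / 2"
  have \<delta>: "\<delta> > 0" using assms by (simp add: \<delta>_def)
  define a where "a = ipE x x"
  have aK: "a \<in> K" by (simp add: a_def ipE_in_K)
  then have "compact (closure (a ` ball 0 1))" by (simp add: compact_ops_def)
  then have "\<exists>A. finite A \<and> closure (a ` ball 0 1) \<subseteq> (\<Union>v\<in>A. ball v \<delta>)"
    using \<delta> compact_eq_totally_bounded[of "closure (a ` ball 0 1)"] by simp
  then obtain A where A: "finite A" "closure (a ` ball 0 1) \<subseteq> (\<Union>v\<in>A. ball v \<delta>)"
    by blast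
  obtain B where B: "finite_orthonormal B"
    and BA: "\<forall>v\<in>A. (\<Sum>g\<in>B. rank_one g g v) = v"
    using gram_schmidt[OF A(1)] by blast
  define P where "P v = (\<Sum>g\<in>B. rank_one g g v)" for v
  have P_diff: "P (v - w) = P v - P w" for v w
    by (simp add: P_def rank_one_diff sum_subtractf)
  have P_sc: "P (scH c v) = scH c (P v)" for c v
    by (simp add: P_def K_sc[OF rank_one_in_K] H.vs.scale_sum_right)
  have contr: "norm (v - P v) \<le> norm v" for v
    unfolding P_def by (rule norm_diff_orthonormal_projection_le[OF B])
  \<comment> \<open>Net points are fixed by \<open>P\<close>, so only the distance of
    \<open>a k\<close> to the nearest one survives, and \<open>1 - P\<close> does not increase
    it.\<close>
  have small: "norm (a k - P (a k)) \<le> \<delta>" if "norm k < 1" for k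
  proof -
    have "a k \<in> closure (a ` ball 0 1)" using that closure_subset by fastforce
    then obtain v where v: "v \<in> A" "norm (a k - v) < \<delta>" 
      using A(2) by (auto simp: dist_norm norm_minus_commute)
    have "P v = v" using BA v(1) by (simp add: P_def)
    then have "norm (a k - P (a k)) = norm ((a k - v) - P (a k - v))" by (simp add: P_diff)
    then show ?thesis using contr[of "a k - v"] v(2) by linarith
  qed
  \<comment> \<open>The factor 2 comes from scaling \<open>k\<close> to norm 1/2, inside the open
    unit ball.\<close>
  have aP: "norm (a k - P (a k)) \<le> (2 * \<delta>) * norm k" for k
  proof (cases "k = 0")
    case True
    then show ?thesis using K_zero[OF aK] P_diff[of 0 0] by simp
  next
    case False
    define t where "t = complex_of_real (1 / (2 * norm k))"
    have "norm (scH t k) < 1" using False by (simp add: t_def norm_scH norm_divide norm_mult)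
    then have "norm (scH t (a k - P (a k))) \<le> \<delta>"
      using small[of "scH t k"] by (simp add: K_sc[OF aK] P_sc H.vs.scale_right_diff_distrib)
    then have "cmod t * norm (a k - P (a k)) \<le> \<delta>" by (simp only: norm_scH)
    moreover have "cmod t = 1 / (2 * norm k)" by (simp add: t_def norm_divide norm_mult)
    ultimately show ?thesis using False by (simp add: field_simps)
  qed
  define y where "y = x - (\<Sum>g\<in>B. act (rank_one g g) x)"
  have y1: "ipE y z h = ipE x z h - P (ipE x z h)" for z h
    by (simp add: y_def ipE_diff ipE_sum ipE_act rank_one_in_K P_def)
  have y2: "ipE z y h = ipE z x (h - P h)" for z h
  proof -
    have lin: "linear (ipE z x)" using K_bounded_linear[OF ipE_in_K] bounded_linear.linear by blast
    have "ipE z y h = ipE z x h - (\<Sum>g\<in>B. ipE z x (rank_one g g h))"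
      by (simp add: y_def ipE_diff ipE_sum_right ipE_act_rank_one_right)
    then show ?thesis by (simp add: P_def linear_diff[OF lin] linear_sum[OF lin])
  qed
  have "norm y \<le> \<epsilon>/2"
  proof (rule norm_E_le)
    fix h k
    have yy: "ipE y y h = a (h - P h) - P (a (h - P h))" by (simp add: y1 y2 a_def)
    have "cmod (ipH (ipE y y h) k) \<le> norm (a (h - P h) - P (a (h - P h))) * norm k"
      unfolding yy by (rule H_cauchy_schwarz)
    also have "\<dots> \<le> ((2 * \<delta>) * norm (h - P h)) * norm k"
      by (intro mult_right_mono aP) simp
    also have "\<dots> \<le> ((2 * \<delta>) * norm h) * norm k"
      using \<delta> contr by (intro mult_right_mono mult_left_mono) auto
    finally show "cmod (ipH (ipE y y h) k) \<le> (\<epsilon>/2)\<^sup>2 * norm h * norm k" by (simp add: \<delta>_def)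
  qed (use assms in simp)
  then show ?thesis using B assms by (intro exI[of _ B]) (auto simp: y_def finite_orthonormal_def)
qed

section \<open>Minimal projections are the rank-one projections\<close>

lemma projection_in_K_rank_one: "norm g = 1 \<Longrightarrow> projection_in_K scH ipH (rank_one g g)"
  using H.G_ip_self[of g] adjH_eqI[OF ipH_rank_one, of g g] rank_one_in_K[of g g]
  by (auto simp: projection_in_K_def fun_eq_iff rank_one_def H.ip_sc)

text \<open>A subprojection \<open>q\<close> is determined by \<open>q g\<close>. Self-adjointness
  makes this a multiple \<open>c\<close> of \<open>g\<close>, and idempotence leaves only
  \<open>c = 0\<close> or \<open>c = 1\<close>.\<close>

lemma minimal_projection_rank_one:
  assumes g: "norm g = 1"
  shows "minimal_projection scH ipH (rank_one g g)"
  unfolding minimal_projection_def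
proof (intro conjI allI impI)
  have gg: "ipH g g = 1" using H.G_ip_self[of g] g by simp
  show "projection_in_K scH ipH (rank_one g g)" by (rule projection_in_K_rank_one[OF g])
  show "rank_one g g \<noteq> (\<lambda>_. 0)"
  proof
    assume "rank_one g g = (\<lambda>_. 0)"
    then have "rank_one g g g = 0" by simp
    then show False using gg g by (simp add: rank_one_def)
  qed
  fix q assume q: "projection_in_K scH ipH q \<and> q \<circ> rank_one g g = q"
  then have qK: "q \<in> K" and qq: "q (q v) = q v" and qg: "q (rank_one g g v) = q v"
    and adj: "ipH (q v) w = ipH v (q w)" for v w
    using ipH_adjH[of q] by (auto simp: projection_in_K_def fun_eq_iff)
  define c where "c = ipH (q g) g"
  have q1: "q v = scH (ipH v g) (q g)" for v
    using qg[of v] by (simp add: rank_one_def K_sc[OF qK])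
  have "q g = scH c g"
  proof (rule ipH_ext_right)
    fix v
    have "ipH v (q g) = ipH (scH (ipH v g) (q g)) g" using adj[of v g] q1[of v] by simp
    also have "\<dots> = cnj c * ipH v g"
      using adj[of g g] H.ip_cnj[of "q g" g] by (simp add: c_def H.ip_sc)
    finally show "ipH v (q g) = ipH v (scH c g)" by (simp add: H.ip_sc_right)
  qed
  then have qv: "q v = scH (c * ipH v g) g" for v using q1[of v] by (simp add: mult.commute)
  have "scH (c * c) g = scH c g" using qq[of g] by (simp add: qv H.ip_sc gg)
  then have "c * c = c" using g by (auto simp: H.vs.scale_cancel_right)
  then have "c = 0 \<or> c = 1" by (metis mult_cancel_left2)
  then show "q = (\<lambda>_. 0) \<or> q = rank_one g g" by (auto simp: qv fun_eq_iff rank_one_def)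
qed

text \<open>A unit vector \<open>k\<close> in the range of \<open>p\<close> gives a nonzero
  projection \<open>rank_one k k\<close> below \<open>p\<close>, which minimality identifies with
  \<open>p\<close>.\<close>

lemma minimal_projectionE:
  assumes "minimal_projection scH ipH p"
  obtains k where "norm k = 1" "p = rank_one k k"
proof -
  have pK: "p \<in> K" and pp: "p (p v) = p v" and adj: "ipH (p v) w = ipH v (p w)" for v w
    using assms ipH_adjH[of p] by (auto simp: projection_in_K_def minimal_projection_def fun_eq_iff)
  obtain v where v: "p v \<noteq> 0" using assms by (auto simp: minimal_projection_def fun_eq_iff)
  define k where "k = scH (complex_of_real (1 / norm (p v))) (p v)"
  have k: "norm k = 1" using v by (simp add: k_def norm_scH norm_divide)
  have pk: "p k = k" by (simp add: k_def K_sc[OF pK] pp)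
  have "rank_one k k \<circ> p = rank_one k k"
    by (simp add: fun_eq_iff rank_one_def adj pk)
  moreover have "rank_one k k \<noteq> (\<lambda>_. 0)"
    using minimal_projection_rank_one[OF k] by (simp add: minimal_projection_def)
  ultimately have "p = rank_one k k"
    using assms projection_in_K_rank_one[OF k] by (auto simp: minimal_projection_def)
  then show ?thesis using that k by blast
qed

text \<open>With p = \<langle>b, b\<rangle>, expanding \<langle>pb - b, pb - b\<rangle> gives zero
  because p is a projection. So \<open>b\<close> lies in the submodule it generates, although the
  algebra has no unit when the Hilbert space is infinite-dimensional.\<close>

lemma act_ipE_self:
  assumes "minimal_projection scH ipH (ipE b b)"
  shows "act (ipE b b) b = b"
proof -
  define p where "p = ipE b b"
  have pK: "p \<in> K" and pp: "p (p v) = p v" and adj: "ipH (p v) w = ipH v (p w)" for v w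
    using assms ipH_adjH[of p]
    by (auto simp: projection_in_K_def minimal_projection_def fun_eq_iff p_def)
  have "act p b - b = 0"
    by (rule ipE_self_zeroD)
      (simp add: ipE_diff ipE_act pK ipE_act_right[OF pK adj] p_def[symmetric] pp)
  then show ?thesis by (simp add: p_def)
qed

section \<open>Generated submodules and closures of submodules\<close>

lemma generated_submoduleI: "b \<in> B \<Longrightarrow> a \<in> K \<Longrightarrow> act a b \<in> generated_submodule scH act B"
  unfolding generated_submodule_def
  by (intro CollectI exI[of _ "Suc 0"] exI[of _ "\<lambda>_. a"] exI[of _ "\<lambda>_. b"]) auto

lemma submodule_generated_submodule: "submodule scH scE act (generated_submodule scH act B)"
  unfolding submodule_def
proof (intro conjI ballI allI)
  show "0 \<in> generated_submodule scH act B"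
    unfolding generated_submodule_def by (intro CollectI exI[of _ 0]) auto
  fix x assume "x \<in> generated_submodule scH act B"
  then obtain n a bs where x: "x = (\<Sum>i<(n::nat). act (a i) (bs i))" "\<And>i. i < n \<Longrightarrow> a i \<in> K"
    "\<And>i. i < n \<Longrightarrow> bs i \<in> B"
    unfolding generated_submodule_def by blast
  show "scE c x \<in> generated_submodule scH act B" for c
    unfolding generated_submodule_def
    by (intro CollectI exI[of _ n] exI[of _ "\<lambda>i h. scH c (a i h)"] exI[of _ bs])
      (auto simp: x K_scale act_sc_left E.scale_sum_right)
  show "act d x \<in> generated_submodule scH act B" if "d \<in> K" for d
    unfolding generated_submodule_def
    by (intro CollectI exI[of _ n] exI[of _ "\<lambda>i. d \<circ> a i"] exI[of _ bs])
      (use that in \<open>auto simp: x K_comp act_comp act_sum\<close>)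
  fix y assume "y \<in> generated_submodule scH act B"
  then obtain m a' bs' where y: "y = (\<Sum>i<(m::nat). act (a' i) (bs' i))" "\<And>i. i < m \<Longrightarrow> a' i \<in> K"
    "\<And>i. i < m \<Longrightarrow> bs' i \<in> B"
    unfolding generated_submodule_def by blast
  have split: "(\<Sum>i<n+m. f i) = (\<Sum>i<n. f i) + (\<Sum>i<m. f (n + i))" for f :: "nat \<Rightarrow> 'e"
    by (induction m) (auto simp: add.assoc)
  show "x + y \<in> generated_submodule scH act B"
    unfolding generated_submodule_def
    by (intro CollectI exI[of _ "n + m"] exI[of _ "\<lambda>i. if i < n then a i else a' (i - n)"]
        exI[of _ "\<lambda>i. if i < n then bs i else bs' (i - n)"]) (use x y in \<open>auto simp: split\<close>)
qed

lemma submodule_closure: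
  assumes "submodule scH scE act X"
  shows "submodule scH scE act (closure X)"
proof -
  have cl: "f x \<in> closure X" if "bounded_linear f" "\<And>x. x \<in> X \<Longrightarrow> f x \<in> X" "x \<in> closure X" for f x
    using image_closure_subset[OF linear_continuous_on[OF that(1)] closed_closure, of X X] that closure_subset
    by blast
  have "x + y \<in> closure X" if xy: "x \<in> closure X" "y \<in> closure X" for x y
  proof -
    obtain s t where "\<forall>n. s n \<in> X" "s \<longlonglongrightarrow> x" "\<forall>n. t n \<in> X" "t \<longlonglongrightarrow> y"
      using xy unfolding closure_sequential by metis
    then have "\<forall>n. s n + t n \<in> X" "(\<lambda>n. s n + t n) \<longlonglongrightarrow> x + y"
      using assms by (auto simp: submodule_def intro: tendsto_add)
    then show ?thesis unfolding closure_sequential by (intro exI[of _ "\<lambda>n. s n + t n"]) auto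
  qed
  moreover have "scE c x \<in> closure X" if "x \<in> closure X" for c x
    using assms by (intro cl[OF bounded_linear_scE _ that]) (auto simp: submodule_def)
  moreover have "act a x \<in> closure X" if "a \<in> K" "x \<in> closure X" for a x
    using assms that(1) by (intro cl[OF bounded_linear_act[OF that(1)] _ that(2)]) (auto simp: submodule_def)
  moreover have "0 \<in> closure X" using assms closure_subset[of X] by (auto simp: submodule_def)
  ultimately show ?thesis unfolding submodule_def by blast
qed

end

section \<open>The corner Hilbert space\<close>

locale hilbert_module_over_K_unit = hilbert_module_over_K scH ipH scE act ipE
  for scH :: "complex \<Rightarrow> 'h::banach \<Rightarrow> 'h" and ipH :: "'h \<Rightarrow> 'h \<Rightarrow> complex"
    and scE :: "complex \<Rightarrow> 'e::banach \<Rightarrow> 'e" and act :: "('h \<Rightarrow> 'h) \<Rightarrow> 'e \<Rightarrow> 'e"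
    and ipE :: "'e \<Rightarrow> 'e \<Rightarrow> ('h \<Rightarrow> 'h)" +
  fixes h0 :: 'h
  assumes norm_h0: "norm h0 = 1"
begin

lemma ipH_h0: "ipH h0 h0 = 1"
  using H.G_ip_self[of h0] norm_h0 by simp

definition phi :: "'e \<Rightarrow> 'e \<Rightarrow> complex" where "phi x y = ipH (ipE x y h0) h0"

text \<open>The corner \<open>eE\<close>, written as the fixed points of the idempotent
  \<open>e\<close>, from which closedness is immediate.\<close>

definition G :: "'e set" where "G = {x. act (rank_one h0 h0) x = x}"

definition fib :: "'h \<Rightarrow> 'e \<Rightarrow> 'e" where "fib h x = act (rank_one h0 h) x"

text \<open>From z = ez follows \<langle>z, y\<rangle> = e \<langle>z, y\<rangle>, whose range lies
  on the line of \<open>h0\<close>. Inner products with elements of \<open>G\<close> are thus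
  governed by scalars.\<close>

lemma G_ipE:
  assumes "z \<in> G"
  shows "ipE z y h = scH (ipH (ipE z y h) h0) h0"
proof -
  have "ipE z y h = ipE (act (rank_one h0 h0) z) y h" using assms by (simp add: G_def)
  also have "\<dots> = scH (ipH (ipE z y h) h0) h0"
    by (simp add: ipE_act rank_one_in_K) (simp add: rank_one_def)
  finally show ?thesis .
qed

lemma phi_self: "phi x x = complex_of_real (Re (phi x x))" "Re (phi x x) \<ge> 0"
  using ipE_self_positive[of x] by (auto simp: positive_op_def phi_def complex_eq_iff)

lemma G_ipE_self:
  assumes "z \<in> G"
  shows "ipE z z h = scH (phi z z * ipH h h0) h0"
proof -
  have "ipH (ipE z z h) h0 = ipH h (scH (phi z z) h0)"
    using G_ipE[OF assms, of z h0] by (simp add: ipH_ipE phi_def)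
  also have "\<dots> = cnj (phi z z) * ipH h h0" by (simp add: H.ip_sc_right)
  also have "cnj (phi z z) = phi z z" by (subst (1 2) phi_self(1)) simp
  finally show ?thesis using G_ipE[OF assms, of z h] by simp
qed

text \<open>By \<open>G_ipE_self\<close>, \<langle>z, z\<rangle> is the multiple \<phi>(z, z) of
  \<open>e\<close>, and \<open>e\<close> has operator norm 1.\<close>

lemma G_norm_phi:
  assumes "z \<in> G"
  shows "norm z = sqrt (Re (phi z z))"
proof -
  have m: "cmod (phi z z) = Re (phi z z)" using phi_self[of z] by (metis norm_of_real abs_of_nonneg)
  have "onorm (ipE z z) \<le> cmod (phi z z)"
  proof (rule onorm_bound)
    show "norm (ipE z z h) \<le> cmod (phi z z) * norm h" for h
      using mult_left_mono[OF H_cauchy_schwarz[of h h0], of "cmod (phi z z)"]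
      by (simp add: G_ipE_self[OF assms] norm_scH norm_mult norm_h0)
  qed simp
  moreover have "cmod (phi z z) \<le> onorm (ipE z z)"
    using onorm[OF K_bounded_linear[OF ipE_in_K], of z z h0]
    by (simp add: G_ipE_self[OF assms] norm_scH norm_mult norm_h0 ipH_h0)
  ultimately show ?thesis using norm_E[of z] m by simp
qed

sublocale G: complex_ip_subspace scE phi G
proof (rule complex_ip_subspace.intro)
  show "phi x y = cnj (phi y x)" for x y
    by (simp add: phi_def ipH_ipE[of x y]) (rule H.ip_cnj)
  have "continuous_on UNIV (act (rank_one h0 h0))"
    by (intro linear_continuous_on bounded_linear_act rank_one_in_K)
  then show "closed G" unfolding G_def by (intro closed_Collect_eq) auto
qed (auto simp: G_norm_phi vector_space_E scaleR_scE phi_def ipE_add H.ip_add ipE_sc H.ip_sc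
    G_def act_zero act_add act_sc rank_one_in_K)

lemma fib_in_G: "fib h x \<in> G"
  by (simp add: G_def fib_def act_rank_one_rank_one ipH_h0)

lemma phi_fib_right: "phi z (fib h y) = ipH (ipE z y h) h0"
  by (simp add: phi_def fib_def ipE_act_rank_one_right) (simp add: rank_one_def ipH_h0)

text \<open>All matrix coefficients of \<langle>x, y\<rangle> are values of \<open>phi\<close> on
  \<open>G\<close>, so norm estimates in \<open>E\<close> reduce to Cauchy-Schwarz in the Hilbert
  space \<open>G\<close>.\<close>

lemma phi_fib: "phi (fib k x) (fib h y) = ipH (ipE x y h) k"
  unfolding phi_fib_right
  by (simp add: fib_def ipE_act rank_one_in_K) (simp add: rank_one_def H.ip_sc ipH_h0)

lemma norm_fib_le: "norm (fib h x) \<le> norm h * norm x"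
proof -
  have "norm (fib h x) \<le> onorm (rank_one h0 h) * norm x"
    unfolding fib_def by (rule norm_act_le[OF rank_one_in_K])
  also have "\<dots> \<le> norm h * norm x"
    using onorm_rank_one_le[of h0 h] by (intro mult_right_mono) (auto simp: norm_h0)
  finally show ?thesis .
qed

lemma norm_ipE_le: "norm (ipE x y h) \<le> norm x * norm y * norm h"
proof (rule norm_H_le)
  fix k
  have "cmod (ipH (ipE x y h) k) \<le> norm (fib k x) * norm (fib h y)"
    unfolding phi_fib[symmetric] by (intro G.cauchy_schwarz fib_in_G)
  also have "\<dots> \<le> (norm k * norm x) * (norm h * norm y)"
    by (intro mult_mono norm_fib_le) auto
  finally show "cmod (ipH (ipE x y h) k) \<le> norm x * norm y * norm h * norm k" by (simp add: mult_ac)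
qed simp

lemma onorm_ipE_le: "onorm (ipE x y) \<le> norm x * norm y"
  by (rule onorm_bound) (auto simp: norm_ipE_le)

lemma norm_sq_le:
  assumes "\<And>h. norm (ipE x x h) \<le> C * norm h" "C \<ge> 0"
  shows "(norm x)\<^sup>2 \<le> C"
  unfolding norm_E_sq by (rule onorm_bound) (use assms in auto)

text \<open>This carries estimates from \<open>G\<close> to \<open>E\<close>: the coefficients of
  \<langle>x, x\<rangle> are inner products of the vectors \<open>fib h x\<close>.\<close>

lemma norm_le_fib:
  assumes "\<And>h. norm (fib h x) \<le> M * norm h" "M \<ge> 0"
  shows "norm x \<le> M"
proof (rule norm_E_le)
  fix h k
  have "cmod (ipH (ipE x x h) k) \<le> norm (fib k x) * norm (fib h x)"
    unfolding phi_fib[symmetric] by (intro G.cauchy_schwarz fib_in_G)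
  also have "\<dots> \<le> (M * norm k) * (M * norm h)"
    by (intro mult_mono assms) (use assms in auto)
  finally show "cmod (ipH (ipE x x h) k) \<le> M\<^sup>2 * norm h * norm k" by (simp add: mult_ac power2_eq_square)
qed (use assms in simp)

lemma bounded_linear_ipE: "bounded_linear (\<lambda>x. ipE x y h)"
proof (rule bounded_linear_intro[where K = "norm y * norm h"])
  show "norm (ipE x y h) \<le> norm x * (norm y * norm h)" for x
    using norm_ipE_le[of x y h] by (simp add: mult.assoc)
qed (simp_all add: ipE_add scaleR_scE ipE_sc H.scaleR_sc)

lemma act_rank_one_fib: "act (rank_one g h0) (fib k x) = act (rank_one g k) x"
  by (simp add: fib_def act_rank_one_rank_one ipH_h0)

text \<open>\<open>x\<close> is a limit of finite sums of \<open>act (rank_one g g) x\<close>, and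
  each summand is recovered from \<open>fib g x\<close> by acting with
  \<open>rank_one g h0\<close>.\<close>

lemma closed_submodule_fib:
  assumes "submodule scH scE act Y" "closed Y" "\<And>h. fib h x \<in> Y"
  shows "x \<in> Y"
proof -
  have sum: "(\<Sum>g\<in>B. act (rank_one g g) x) \<in> Y" for B
  proof (induction B rule: infinite_finite_induct)
    case (insert g B)
    have "act (rank_one g h0) (fib g x) \<in> Y"
      using assms by (auto simp: submodule_def rank_one_in_K)
    then show ?case using insert assms(1) by (simp add: submodule_def act_rank_one_fib)
  qed (use assms in \<open>auto simp: submodule_def\<close>)
  have "x \<in> closure Y"
    unfolding closure_approachable
  proof (intro allI impI)
    fix \<epsilon> :: real assume "\<epsilon> > 0"
    then obtain B where "norm (x - (\<Sum>g\<in>B. act (rank_one g g) x)) < \<epsilon>"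
      using approx_act_finite_rank by blast
    then show "\<exists>y\<in>Y. dist y x < \<epsilon>" using sum[of B]
      by (intro bexI[of _ "\<Sum>g\<in>B. act (rank_one g g) x"]) (auto simp: dist_norm norm_minus_commute)
  qed
  then show ?thesis using assms(2) by simp
qed

text \<open>Some \<open>fib g x\<close> with \<open>x\<close> in \<open>X\<close> lies outside
  \<open>Y\<close>. Subtracting its projection onto \<open>Y \<inter> G\<close>, taken in the
  Hilbert space \<open>G\<close>, and normalising gives the vector.\<close>

lemma closed_submodule_orthogonal_vector:
  assumes Y: "submodule scH scE act Y" "closed Y" and X: "submodule scH scE act X"
    and sub: "Y \<subseteq> X" "\<not> X \<subseteq> Y"
  shows "\<exists>z\<in>X \<inter> G. norm z = 1 \<and> (\<forall>y\<in>Y. \<forall>h. ipE z y h = 0)"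
proof -
  obtain x where x: "x \<in> X" "x \<notin> Y" using sub by blast
  then obtain g where g: "fib g x \<notin> Y" using closed_submodule_fib[OF Y] by blast
  have fX: "fib g x \<in> X" using x X by (auto simp: fib_def submodule_def rank_one_in_K)
  have "\<exists>u\<in>Y \<inter> G. \<forall>w\<in>Y \<inter> G. phi (fib g x - u) w = 0"
  proof (rule G.orthogonal_projection_exists)
    show "closed (Y \<inter> G)" using Y G.G_closed by blast
  qed (use Y in \<open>auto simp: submodule_def G.G_zero G.G_add G.G_sc fib_in_G\<close>)
  then obtain u where u: "u \<in> Y" "u \<in> G" "\<And>w. w \<in> Y \<Longrightarrow> w \<in> G \<Longrightarrow> phi (fib g x - u) w = 0"
    by blast
  define z where "z = fib g x - u"
  define z' where "z' = scE (complex_of_real (1 / norm z)) z"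
  have z0: "z \<noteq> 0" using g u by (auto simp: z_def)
  have zG: "z \<in> G" unfolding z_def by (intro G.G_diff fib_in_G u)
  have "scE (-1) u \<in> X" using u(1) sub(1) X unfolding submodule_def by blast
  then have "- u \<in> X" by simp
  then have "fib g x + (- u) \<in> X" using fX X unfolding submodule_def by blast
  then have zX: "z \<in> X" by (simp add: z_def)
  \<comment> \<open>Orthogonality for \<open>phi\<close> lifts to \<open>ipE\<close>: as
    \<open>z\<close> lies in \<open>G\<close>, the value is determined by
    \<open>phi z (fib h y)\<close>, and \<open>fib h y\<close> stays in \<open>Y\<close>.\<close>
  have "ipE z y h = 0" if y: "y \<in> Y" for y h
  proof -
    have "fib h y \<in> Y" using y Y by (auto simp: fib_def submodule_def rank_one_in_K)
    then have "phi z (fib h y) = 0" unfolding z_def by (intro u fib_in_G)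
    then show ?thesis using G_ipE[OF zG, of y h] by (simp add: phi_fib_right)
  qed
  then have "\<forall>y\<in>Y. \<forall>h. ipE z' y h = 0" by (simp add: z'_def ipE_sc)
  moreover have "norm z' = 1" using z0 by (simp add: z'_def G.G_norm_sc[OF zG] norm_divide)
  moreover have "z' \<in> X \<inter> G" using zX X zG by (auto simp: z'_def G.G_sc submodule_def)
  ultimately show ?thesis by blast
qed

text \<open>Zorn's lemma gives a maximal orthonormal system. If it did not generate a dense
  submodule, a unit vector of \<open>G\<close> orthogonal to that submodule would enlarge
  it.\<close>

lemma orthonormal_basis_exists:
  assumes X: "submodule scH scE act X" "closed X"
  shows "\<exists>B. orthonormal_basis scH ipH act ipE X B"
proof -
  let ?A = "{B. orthonormal_system scH ipH ipE X B}"
  have "\<exists>M\<in>?A. \<forall>B\<in>?A. M \<subseteq> B \<longrightarrow> B = M"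
  proof (rule subset_Zorn')
    fix C assume C: "subset.chain ?A C"
    have "ipE b b' = (\<lambda>_. 0)" if bC: "b \<in> \<Union>C" "b' \<in> \<Union>C" and bb: "b \<noteq> b'" for b b'
    proof -
      obtain B B' where B: "B \<in> C" "b \<in> B" "B' \<in> C" "b' \<in> B'" using bC by blast
      then have "B \<subseteq> B' \<or> B' \<subseteq> B" using C by (auto simp: subset_chain_def)
      then obtain D where "D \<in> C" "b \<in> D" "b' \<in> D" using B by blast
      moreover have "D \<in> ?A" using C \<open>D \<in> C\<close> by (auto simp: subset_chain_def)
      ultimately show ?thesis using bb by (auto simp: orthonormal_system_def)
    qed
    moreover have "orthonormal_system scH ipH ipE X B" if "B \<in> C" for B
      using C that by (auto simp: subset_chain_def)
    then have "\<And>B. B \<in> C \<Longrightarrow> B \<subseteq> X" "\<And>B b. B \<in> C \<Longrightarrow> b \<in> B \<Longrightarrow> minimal_projection scH ipH (ipE b b)"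
      by (simp_all add: orthonormal_system_def)
    then have "\<Union>C \<subseteq> X" "\<forall>b\<in>\<Union>C. minimal_projection scH ipH (ipE b b)" by auto
    ultimately show "\<Union>C \<in> ?A" by (simp only: orthonormal_system_def mem_Collect_eq) simp
  qed
  then obtain B where B: "orthonormal_system scH ipH ipE X B"
    and max: "\<And>B'. orthonormal_system scH ipH ipE X B' \<Longrightarrow> B \<subseteq> B' \<Longrightarrow> B' = B" by blast
  let ?gen = "generated_submodule scH act B"
  have BX: "B \<subseteq> X" using B by (simp add: orthonormal_system_def)
  have "?gen \<subseteq> X"
  proof
    fix x assume "x \<in> ?gen"
    then obtain n a bs where x: "x = (\<Sum>i<(n::nat). act (a i) (bs i))" "\<forall>i<n. a i \<in> K \<and> bs i \<in> B"
      unfolding generated_submodule_def by blast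
    have "(\<Sum>i<m. act (a i) (bs i)) \<in> X" if "m \<le> n" for m
      using that
    proof (induction m)
      case (Suc m)
      then have "a m \<in> K" "bs m \<in> X" using BX x(2) by auto
      then have "act (a m) (bs m) \<in> X" using X(1) by (simp add: submodule_def)
      then show ?case using Suc X(1) by (simp add: submodule_def)
    qed (use X(1) in \<open>simp add: submodule_def\<close>)
    then show "x \<in> X" using x by simp
  qed
  then have YX: "closure ?gen \<subseteq> X" using X by (intro closure_minimal)
  have "X \<subseteq> closure ?gen"
  proof (rule ccontr)
    assume "\<not> X \<subseteq> closure ?gen"
    then obtain z where z: "z \<in> X" "z \<in> G" "norm z = 1" "\<And>y h. y \<in> closure ?gen \<Longrightarrow> ipE z y h = 0"
      using closed_submodule_orthogonal_vector
        [OF submodule_closure[OF submodule_generated_submodule] closed_closure X(1) YX] by blast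
    have zB: "ipE z b = (\<lambda>_. 0)" if "b \<in> B" for b
    proof -
      have "act (ipE b b) b \<in> ?gen" using that by (rule generated_submoduleI[OF _ ipE_in_K])
      then have "b \<in> ?gen" using act_ipE_self[of b] B that by (simp add: orthonormal_system_def)
      then show ?thesis using z(4) closure_subset by fastforce
    qed
    have Bz: "ipE b z = (\<lambda>_. 0)" if "b \<in> B" for b
      by (rule ext, rule ipH_ext) (simp add: ipH_ipE zB[OF that] H.ip_zero)
    \<comment> \<open>A unit vector of \<open>G\<close> has inner square \<open>e\<close>, a minimal
      projection, so it is admissible in an orthonormal system.\<close>
    have "phi z z = 1" using G.G_ip_self[OF z(2)] z(3) by simp
    then have "ipE z z = rank_one h0 h0"
      by (simp add: fun_eq_iff G_ipE_self[OF z(2)] rank_one_def)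
    then have "minimal_projection scH ipH (ipE z z)"
      using minimal_projection_rank_one[OF norm_h0] by simp
    then have "orthonormal_system scH ipH ipE X (insert z B)"
      using B zB Bz z(1) by (auto simp: orthonormal_system_def)
    then have "insert z B = B" by (intro max) auto
    then have "z \<in> B" by blast
    then have "z = 0" using zB ipE_self_eq_0_iff by blast
    then show False using z(3) by simp
  qed
  then show ?thesis using B by (auto simp: orthonormal_basis_def)
qed

section \<open>Adjointable and compact operators\<close>

lemma adjointable_adjE:
  assumes "adjointable ipE S"
  shows "ipE (S x) y = ipE x (adjE ipE S y)"
proof -
  have "\<forall>x y. ipE (S x) y = ipE x (adjE ipE S y)"
    unfolding adjE_def by (rule someI_ex[OF assms[unfolded adjointable_def]])
  then show ?thesis by blast
qed

lemma adjE_adjoint: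
  assumes "adjointable ipE S"
  shows "ipE (adjE ipE S x) y = ipE x (S y)"
  by (rule ext, rule ipH_ext) (simp add: ipH_ipE adjointable_adjE[OF assms])

lemma adjointable_adjE_self: "adjointable ipE S \<Longrightarrow> adjointable ipE (adjE ipE S)"
  unfolding adjointable_def[of _ "adjE ipE S"] using adjE_adjoint by blast

lemma adjointable_add: "adjointable ipE S \<Longrightarrow> S (x + y) = S x + S y"
  by (rule ipE_ext) (simp add: ipE_add adjointable_adjE)

lemma adjointable_sc: "adjointable ipE S \<Longrightarrow> S (scE c x) = scE c (S x)"
  by (rule ipE_ext) (simp add: ipE_sc adjointable_adjE)

lemma adjointable_act: "adjointable ipE S \<Longrightarrow> a \<in> K \<Longrightarrow> S (act a x) = act a (S x)"
  by (rule ipE_ext) (simp add: ipE_act adjointable_adjE)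

lemma adjointable_fib: "adjointable ipE S \<Longrightarrow> S (fib h x) = fib h (S x)"
  by (simp add: fib_def adjointable_act rank_one_in_K)

lemma adjointable_G: "adjointable ipE S \<Longrightarrow> x \<in> G \<Longrightarrow> S x \<in> G"
  using adjointable_act[OF _ rank_one_in_K, of S h0 h0 x] by (simp add: G_def)

text \<open>Closed graph theorem: the graph is cut out by the closed conditions that \<langle>Sx,
  z\<rangle> equals the inner product of x with the adjoint applied to z.\<close>

lemma adjointable_bounded_linear:
  assumes "adjointable ipE S"
  shows "bounded_linear S"
proof (rule closed_graph_imp_bounded_linear)
  show "linear S"
    by (rule linearI) (simp_all add: adjointable_add adjointable_sc scaleR_scE assms)
  have "{(x, S x) | x. True} = (\<Inter>z. \<Inter>h. {p. ipE (snd p) z h = ipE (fst p) (adjE ipE S z) h})"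
  proof (intro set_eqI iffI)
    fix p assume "p \<in> {(x, S x) | x. True}"
    then show "p \<in> (\<Inter>z. \<Inter>h. {p. ipE (snd p) z h = ipE (fst p) (adjE ipE S z) h})"
      by (auto simp: adjointable_adjE[OF assms])
  next
    fix p assume p: "p \<in> (\<Inter>z. \<Inter>h. {p. ipE (snd p) z h = ipE (fst p) (adjE ipE S z) h})"
    then have "snd p = S (fst p)"
      by (intro ipE_ext) (simp add: adjointable_adjE[OF assms])
    then show "p \<in> {(x, S x) | x. True}" by (cases p) simp
  qed
  moreover have "closed {p. ipE (snd p) z h = ipE (fst p) (adjE ipE S z) h}" for z h
    by (intro closed_Collect_eq linear_continuous_on
        bounded_linear_compose[OF bounded_linear_ipE bounded_linear_snd]
        bounded_linear_compose[OF bounded_linear_ipE bounded_linear_fst])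
  ultimately show "closed {(x, S x) | x. True}" by (simp add: closed_INT)
qed

lemma submodule_kernel:
  assumes "adjointable ipE S"
  shows "submodule scH scE act {x. S x = 0}" "closed {x. S x = 0}"
proof -
  have "S 0 = 0" using adjointable_add[OF assms, of 0 0] by simp
  then show "submodule scH scE act {x. S x = 0}"
    using assms by (auto simp: submodule_def adjointable_add adjointable_sc adjointable_act act_zero)
  have "continuous_on UNIV S" using adjointable_bounded_linear[OF assms] by (rule linear_continuous_on)
  then show "closed {x. S x = 0}" by (intro closed_Collect_eq) auto
qed

lemma submodule_range:
  assumes "adjointable ipE S"
  shows "submodule scH scE act (range S)"
proof -
  have "S 0 = 0" using adjointable_add[OF assms, of 0 0] by simp
  then show ?thesis
    unfolding submodule_def
    by (auto simp flip: adjointable_add[OF assms] adjointable_sc[OF assms] adjointable_act[OF assms])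
qed

section \<open>The operators \<open>Theta\<close>, their span, and compactness on the corner\<close>

lemma norm_Theta_le: "norm (Theta act ipE x y z) \<le> norm x * norm y * norm z"
proof -
  have "norm (Theta act ipE x y z) \<le> onorm (ipE z x) * norm y"
    unfolding Theta_def by (rule norm_act_le[OF ipE_in_K])
  also have "\<dots> \<le> (norm z * norm x) * norm y" by (intro mult_right_mono onorm_ipE_le) simp
  finally show ?thesis by (simp add: mult_ac)
qed

lemma ipE_add_fun: "ipE (x + y) z = (\<lambda>h. ipE x z h + ipE y z h)"
  by (rule ext) (rule ipE_add)

lemma ipE_sc_fun: "ipE (scE c x) z = (\<lambda>h. scH c (ipE x z h))"
  by (rule ext) (rule ipE_sc)

lemma bounded_linear_Theta: "bounded_linear (Theta act ipE x y)"
proof (rule bounded_linear_intro[where K = "norm x * norm y"])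
  show "norm (Theta act ipE x y z) \<le> norm z * (norm x * norm y)" for z
    using norm_Theta_le[of x y z] by (simp add: mult_ac)
qed (simp_all add: Theta_def ipE_add_fun ipE_sc_fun scaleR_scE act_add_left act_sc_left ipE_in_K)

lemma scE_Theta: "scE c (Theta act ipE x y z) = Theta act ipE x (scE c y) z"
  by (simp add: Theta_def act_sc ipE_in_K)

text \<open>The scalar coefficients are absorbed into the second vectors.\<close>

lemma Theta_spanE:
  assumes "F \<in> Theta_span scE act ipE"
  obtains n xs ys where "F = (\<lambda>z. \<Sum>i<(n::nat). Theta act ipE (xs i) (ys i) z)"
proof -
  obtain n c xs ys where "F = (\<lambda>z. \<Sum>i<(n::nat). scE (c i) (Theta act ipE (xs i) (ys i) z))"
    using assms unfolding Theta_span_def by blast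
  then have "F = (\<lambda>z. \<Sum>i<n. Theta act ipE (xs i) (scE (c i) (ys i)) z)" by (simp only: scE_Theta)
  then show ?thesis by (rule that)
qed

lemma bounded_linear_Theta_span: "F \<in> Theta_span scE act ipE \<Longrightarrow> bounded_linear F"
  by (erule Theta_spanE) (simp add: bounded_linear_sum bounded_linear_Theta)

text \<open>Total boundedness of the image of the unit ball of \<open>G\<close>. The ball of
  \<open>E\<close> would be too large: on infinite-dimensional \<open>H\<close>, already a single
  \<open>Theta\<close> can have a non-compact image there.\<close>

definition precompact_on_G :: "('e \<Rightarrow> 'e) \<Rightarrow> bool" where
  "precompact_on_G S \<longleftrightarrow> (\<forall>\<epsilon>>0. \<exists>A. finite A \<and> (\<forall>z\<in>G. norm z \<le> 1 \<longrightarrow> (\<exists>a\<in>A. norm (S z - a) < \<epsilon>)))"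

lemma precompact_on_G_add:
  assumes "precompact_on_G S" "precompact_on_G R"
  shows "precompact_on_G (\<lambda>z. S z + R z)"
  unfolding precompact_on_G_def
proof (intro allI impI)
  fix \<epsilon> :: real assume "\<epsilon> > 0"
  then have e: "\<epsilon> / 2 > 0" by simp
  obtain A where A: "finite A" "\<And>z. z \<in> G \<Longrightarrow> norm z \<le> 1 \<Longrightarrow> \<exists>a\<in>A. norm (S z - a) < \<epsilon> / 2"
    using assms(1) e unfolding precompact_on_G_def by metis
  obtain B where B: "finite B" "\<And>z. z \<in> G \<Longrightarrow> norm z \<le> 1 \<Longrightarrow> \<exists>a\<in>B. norm (R z - a) < \<epsilon> / 2"
    using assms(2) e unfolding precompact_on_G_def by metis
  show "\<exists>A. finite A \<and> (\<forall>z\<in>G. norm z \<le> 1 \<longrightarrow> (\<exists>a\<in>A. norm (S z + R z - a) < \<epsilon>))"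
  proof (intro exI[of _ "(\<lambda>(a,b). a + b) ` (A \<times> B)"] conjI ballI impI)
    show "finite ((\<lambda>(a,b). a + b) ` (A \<times> B))" using A B by simp
    fix z assume z: "z \<in> G" "norm z \<le> 1"
    obtain a b where ab: "a \<in> A" "norm (S z - a) < \<epsilon> / 2" "b \<in> B" "norm (R z - b) < \<epsilon> / 2"
      using A(2)[OF z] B(2)[OF z] by blast
    have "norm (S z + R z - (a + b)) \<le> norm (S z - a) + norm (R z - b)"
      by (rule norm_diff_triangle_ineq)
    then have "norm (S z + R z - (a + b)) < \<epsilon>" using ab by linarith
    then show "\<exists>c\<in>(\<lambda>(a,b). a + b) ` (A \<times> B). norm (S z + R z - c) < \<epsilon>" using ab by force
  qed
qed

lemma precompact_on_G_sum:
  assumes "\<And>i. i \<in> I \<Longrightarrow> precompact_on_G (S i)"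
  shows "precompact_on_G (\<lambda>z. \<Sum>i\<in>I. S i z)"
  using assms
proof (induction I rule: infinite_finite_induct)
  case (insert i I)
  then show ?case by (simp add: precompact_on_G_add)
qed (auto simp: precompact_on_G_def intro!: exI[of _ "{0}"])

lemma precompact_on_G_limit:
  assumes "\<And>\<epsilon>. \<epsilon> > 0 \<Longrightarrow> \<exists>R. precompact_on_G R \<and> (\<forall>z\<in>G. norm z \<le> 1 \<longrightarrow> norm (S z - R z) \<le> \<epsilon>)"
  shows "precompact_on_G S"
  unfolding precompact_on_G_def
proof (intro allI impI)
  fix \<epsilon> :: real assume "\<epsilon> > 0"
  then have e: "\<epsilon> / 2 > 0" by simp
  obtain R where R: "precompact_on_G R" "\<And>z. z \<in> G \<Longrightarrow> norm z \<le> 1 \<Longrightarrow> norm (S z - R z) \<le> \<epsilon> / 2"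
    using assms[OF e] by blast
  obtain A where A: "finite A" "\<And>z. z \<in> G \<Longrightarrow> norm z \<le> 1 \<Longrightarrow> \<exists>a\<in>A. norm (R z - a) < \<epsilon> / 2"
    using R(1) e unfolding precompact_on_G_def by metis
  show "\<exists>A. finite A \<and> (\<forall>z\<in>G. norm z \<le> 1 \<longrightarrow> (\<exists>a\<in>A. norm (S z - a) < \<epsilon>))"
  proof (intro exI[of _ A] conjI ballI impI A(1))
    fix z assume z: "z \<in> G" "norm z \<le> 1"
    obtain a where a: "a \<in> A" "norm (R z - a) < \<epsilon> / 2" using A(2)[OF z] by blast
    have "norm (S z - a) < \<epsilon>"
      using norm_triangle_ineq[of "S z - R z" "R z - a"] a R(2)[OF z] by simp
    then show "\<exists>a\<in>A. norm (S z - a) < \<epsilon>" using a by blast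
  qed
qed

lemma precompact_on_G_scalar:
  assumes "\<And>z :: 'e. norm z \<le> 1 \<Longrightarrow> cmod (c z) \<le> M"
  shows "precompact_on_G (\<lambda>z. scE (c z) y)"
  unfolding precompact_on_G_def
proof (intro allI impI)
  fix \<epsilon> :: real assume "\<epsilon> > 0"
  let ?C = "(\<lambda>t. scE t y) ` cball 0 M"
  have "compact ?C"
    by (intro compact_continuous_image linear_continuous_on bounded_linear_scE_left) simp
  then have "\<exists>A. finite A \<and> ?C \<subseteq> (\<Union>a\<in>A. ball a \<epsilon>)"
    using \<open>\<epsilon> > 0\<close> compact_eq_totally_bounded[of ?C] by simp
  then obtain A where A: "finite A" "?C \<subseteq> (\<Union>a\<in>A. ball a \<epsilon>)" by blast
  show "\<exists>A. finite A \<and> (\<forall>z\<in>G. norm z \<le> 1 \<longrightarrow> (\<exists>a\<in>A. norm (scE (c z) y - a) < \<epsilon>))"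
  proof (intro exI[of _ A] conjI ballI impI A(1))
    fix z :: 'e assume "norm z \<le> 1"
    then have "scE (c z) y \<in> ?C" using assms by auto
    then obtain a where "a \<in> A" "scE (c z) y \<in> ball a \<epsilon>" using A(2) by blast
    then show "\<exists>a\<in>A. norm (scE (c z) y - a) < \<epsilon>"
      by (auto simp: dist_norm norm_minus_commute)
  qed
qed

lemma Theta_act_rank_one:
  assumes "z \<in> G"
  shows "Theta act ipE x (act (rank_one g g) y) z = scE (ipH (ipE z x g) h0) (fib g y)"
proof -
  let ?c = "ipH (ipE z x g) h0"
  have "rank_one (ipE z x g) g = (\<lambda>h. scH ?c (rank_one h0 g h))"
    by (subst G_ipE[OF assms]) (simp add: rank_one_def mult.commute)
  then show ?thesis
    by (simp add: Theta_def act_comp_rank_one ipE_in_K act_sc_left rank_one_in_K fib_def)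
qed

text \<open>
  For \<open>z\<close> in \<open>G\<close> the operator \<open>\<langle>z, x\<rangle>\<close> has range in the span of \<open>h\<^sub>0\<close>, so replacing \<open>y\<close> by a finite-rank
  approximation \<open>py\<close> turns \<open>\<Theta>(x, y)\<close> into a finite-rank operator on \<open>G\<close>.
\<close>

lemma precompact_on_G_Theta: "precompact_on_G (Theta act ipE x y)"
proof (rule precompact_on_G_limit)
  fix \<epsilon> :: real assume e: "\<epsilon> > 0"
  define \<delta> where "\<delta> = \<epsilon> / (norm x + 1)"
  have d: "\<delta> > 0" using e by (simp add: \<delta>_def add_nonneg_pos)
  obtain B where B: "finite B" "norm (y - (\<Sum>g\<in>B. act (rank_one g g) y)) < \<delta>"
    using approx_act_finite_rank[OF d] by blast
  let ?R = "\<lambda>z. \<Sum>g\<in>B. scE (ipH (ipE z x g) h0) (fib g y)"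
  have "precompact_on_G ?R"
  proof (rule precompact_on_G_sum, rule precompact_on_G_scalar)
    fix g z assume z: "norm (z::'e) \<le> 1"
    have "cmod (ipH (ipE z x g) h0) \<le> norm (ipE z x g)"
      using H_cauchy_schwarz[of "ipE z x g" h0] by (simp add: norm_h0)
    also have "\<dots> \<le> norm z * (norm x * norm g)" using norm_ipE_le[of z x g] by (simp add: mult.assoc)
    also have "\<dots> \<le> 1 * (norm x * norm g)" by (intro mult_right_mono z) simp
    finally show "cmod (ipH (ipE z x g) h0) \<le> norm x * norm g" by simp
  qed
  moreover have "norm (Theta act ipE x y z - ?R z) \<le> \<epsilon>" if z: "z \<in> G" "norm z \<le> 1" for z
  proof -
    let ?y = "\<Sum>g\<in>B. act (rank_one g g) y"
    have "?R z = Theta act ipE x ?y z"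
      by (simp add: Theta_act_rank_one[OF z(1), symmetric]) (simp add: Theta_def act_sum ipE_in_K)
    then have "Theta act ipE x y z - ?R z = Theta act ipE x (y - ?y) z"
      by (simp add: Theta_def act_diff ipE_in_K)
    then have "norm (Theta act ipE x y z - ?R z) \<le> norm x * norm (y - ?y) * norm z"
      using norm_Theta_le by simp
    also have "\<dots> \<le> norm x * \<delta> * 1" using B(2) z(2) d by (intro mult_mono) auto
    also have "\<dots> \<le> (norm x + 1) * \<delta>" using d by (simp add: algebra_simps)
    also have "\<dots> = \<epsilon>" by (simp add: \<delta>_def add_nonneg_eq_0_iff)
    finally show ?thesis .
  qed
  ultimately show "\<exists>R. precompact_on_G R \<and> (\<forall>z\<in>G. norm z \<le> 1 \<longrightarrow> norm (Theta act ipE x y z - R z) \<le> \<epsilon>)"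
    by blast
qed

lemma precompact_on_G_compact_ops_E:
  assumes "S \<in> compact_ops_E scE act ipE"
  shows "precompact_on_G S"
proof (rule precompact_on_G_limit)
  fix \<epsilon> :: real assume "\<epsilon> > 0"
  then obtain F where F: "F \<in> Theta_span scE act ipE" "onorm (\<lambda>z. S z - F z) < \<epsilon>"
    using assms unfolding compact_ops_E_def by blast
  have "precompact_on_G F"
    using F(1) by (rule Theta_spanE) (simp add: precompact_on_G_sum precompact_on_G_Theta)
  moreover have "norm (S z - F z) \<le> \<epsilon>" if "norm z \<le> 1" for z
  proof -
    \<comment> \<open>\<open>onorm\<close> bounds pointwise values for bounded linear maps;
      adjointability of \<open>S\<close> supplies this.\<close>
    have bl: "bounded_linear (\<lambda>z. S z - F z)"
      using assms F(1) by (intro bounded_linear_sub adjointable_bounded_linear bounded_linear_Theta_span)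
        (auto simp: compact_ops_E_def)
    have "norm (S z - F z) \<le> onorm (\<lambda>z. S z - F z) * norm z" by (rule onorm[OF bl])
    also have "\<dots> \<le> \<epsilon> * 1" using F(2) that \<open>\<epsilon> > 0\<close> by (intro mult_mono) auto
    finally show ?thesis by simp
  qed
  ultimately show "\<exists>R. precompact_on_G R \<and> (\<forall>z\<in>G. norm z \<le> 1 \<longrightarrow> norm (S z - R z) \<le> \<epsilon>)" by blast
qed

lemma precompact_on_G_compact_closure:
  assumes "precompact_on_G S"
  shows "compact (closure (S ` (G \<inter> cball 0 1)))"
  unfolding compact_eq_totally_bounded
proof (intro conjI allI impI)
  show "complete (closure (S ` (G \<inter> cball 0 1)))" by (simp add: complete_eq_closed)
  fix \<epsilon> :: real assume "\<epsilon> > 0"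
  then have "\<epsilon> / 2 > 0" by simp
  then obtain A where A: "finite A" "\<And>z. z \<in> G \<Longrightarrow> norm z \<le> 1 \<Longrightarrow> \<exists>a\<in>A. norm (S z - a) < \<epsilon> / 2"
    using assms unfolding precompact_on_G_def by metis
  \<comment> \<open>Closed balls of half the radius form a closed finite union, so the cover passes
    to the closure.\<close>
  have "S ` (G \<inter> cball 0 1) \<subseteq> (\<Union>a\<in>A. cball a (\<epsilon> / 2))"
    using A(2) by (fastforce simp: dist_norm norm_minus_commute)
  then have "closure (S ` (G \<inter> cball 0 1)) \<subseteq> (\<Union>a\<in>A. cball a (\<epsilon> / 2))"
    using A(1) by (intro closure_minimal closed_UN) auto
  also have "\<dots> \<subseteq> (\<Union>a\<in>A. ball a \<epsilon>)" using \<open>\<epsilon> > 0\<close> by fastforce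
  finally show "\<exists>A. finite A \<and> closure (S ` (G \<inter> cball 0 1)) \<subseteq> (\<Union>a\<in>A. ball a \<epsilon>)"
    using A(1) by blast
qed

section \<open>Fredholm operators\<close>

text \<open>
  Moving the basis vectors to an orthonormal set \<open>u\<close> in \<open>G\<close>, the hypothesis gives
  \<open>\<phi>(k u\<^sub>b, u\<^sub>c) = -\<delta>\<^sub>b\<^sub>c\<close>, so the images \<open>k u\<^sub>b\<close> have mutual distance at least 1.
\<close>

lemma orthonormal_system_finite:
  assumes B: "orthonormal_system scH ipH ipE X B" and X: "submodule scH scE act X"
    and k: "k \<in> compact_ops_E scE act ipE"
    and kX: "\<And>x y h. x \<in> X \<Longrightarrow> y \<in> X \<Longrightarrow> ipE (k x) y h = - ipE x y h"
  shows "finite B"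
proof -
  have adj: "adjointable ipE k" using k by (simp add: compact_ops_E_def)
  have "\<exists>g. norm g = 1 \<and> ipE b b = rank_one g g" if "b \<in> B" for b
    using that B minimal_projectionE by (metis orthonormal_system_def)
  then obtain g where g: "\<And>b. b \<in> B \<Longrightarrow> norm (g b) = 1" "\<And>b. b \<in> B \<Longrightarrow> ipE b b = rank_one (g b) (g b)"
    by metis
  define u where "u b = fib (g b) b" for b
  have uX: "u b \<in> X" if "b \<in> B" for b
    using that B X by (auto simp: u_def fib_def submodule_def rank_one_in_K orthonormal_system_def)
  have phi_u: "phi (u b) (u c) = (if b = c then 1 else 0)" if "b \<in> B" "c \<in> B" for b c
  proof (cases "b = c")
    case True
    have "ipH (g b) (g b) = 1" using H.G_ip_self[of "g b"] g(1)[OF that(1)] by simp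
    then show ?thesis using True g(2)[OF that(1)]
      by (simp add: u_def phi_fib) (simp add: rank_one_def)
  next
    case False
    then have "ipE b c = (\<lambda>_. 0)" using B that by (simp add: orthonormal_system_def)
    then show ?thesis using False by (simp add: u_def phi_fib H.ip_zero)
  qed
  have uG: "u b \<in> G" for b by (simp add: u_def fib_in_G)
  have nu: "norm (u b) = 1" if "b \<in> B" for b
    using G.G_norm[OF uG, of b] phi_u[OF that that] by simp
  \<comment> \<open>Radius 1/2 fits the separation by 1: two different basis vectors cannot share a
    net point, so the map \<open>\<alpha>\<close> into the finite net is injective.\<close>
  have "(1/2::real) > 0" by simp
  then obtain A where A: "finite A" "\<And>z. z \<in> G \<Longrightarrow> norm z \<le> 1 \<Longrightarrow> \<exists>a\<in>A. norm (k z - a) < 1/2"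
    using precompact_on_G_compact_ops_E[OF k] unfolding precompact_on_G_def by metis
  have "\<exists>a\<in>A. norm (k (u b) - a) < 1/2" if "b \<in> B" for b
    using A(2)[OF uG] nu[OF that] by simp
  then obtain \<alpha> where \<alpha>: "\<And>b. b \<in> B \<Longrightarrow> \<alpha> b \<in> A" "\<And>b. b \<in> B \<Longrightarrow> norm (k (u b) - \<alpha> b) < 1/2"
    by metis
  have "inj_on \<alpha> B"
  proof (rule inj_onI, rule ccontr)
    fix b c assume bc: "b \<in> B" "c \<in> B" "\<alpha> b = \<alpha> c" "b \<noteq> c"
    have "norm (k (u b) - k (u c)) < 1"
      using norm_triangle_ineq4[of "k (u b) - \<alpha> b" "k (u c) - \<alpha> c"] \<alpha>(2)[OF bc(1)] \<alpha>(2)[OF bc(2)] bc(3)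
      by simp
    moreover have "phi (k (u b) - k (u c)) (u b) = - phi (u b) (u b) + phi (u c) (u b)"
      using kX uX bc by (simp add: phi_def ipE_diff H.ip_diff H.ip_minus)
    then have "phi (k (u b) - k (u c)) (u b) = - 1"
      using phi_u bc by simp
    then have "1 \<le> norm (k (u b) - k (u c)) * norm (u b)"
      using G.cauchy_schwarz[of "k (u b) - k (u c)" "u b"] by (simp add: uG adjointable_G[OF adj] G.G_diff)
    ultimately show False using nu[OF bc(1)] by simp
  qed
  then show ?thesis using A(1) \<alpha>(1) by (meson image_subsetI inj_on_finite)
qed

text \<open>The existence of a basis matters here: \<open>finite_dimK\<close> picks one with \<open>SOME\<close>.\<close>

lemma finite_dimK_basisE:
  assumes "submodule scH scE act X" "closed X" "finite_dimK scH ipH act ipE X"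
  obtains B where "orthonormal_basis scH ipH act ipE X B" "finite B"
  using that someI_ex[OF orthonormal_basis_exists[OF assms(1,2)]] assms(3)
  by (simp add: finite_dimK_def)

section \<open>Orthogonal projections given by finite orthonormal bases\<close>

definition basis_projection :: "'e set \<Rightarrow> 'e \<Rightarrow> 'e" where
  "basis_projection B x = (\<Sum>b\<in>B. Theta act ipE b b x)"

lemma basis_projection_adjoint:
  "ipE (basis_projection B x) y = ipE x (basis_projection B y)"
proof
  fix h
  have "ipE x (act (ipE y b) b) h = ipE x b (ipE b y h)" for b
    by (rule ipE_act_right[OF ipE_in_K ipH_ipE])
  then show "ipE (basis_projection B x) y h = ipE x (basis_projection B y) h"
    by (simp add: basis_projection_def Theta_def ipE_sum ipE_sum_right ipE_act ipE_in_K)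
qed

lemma adjointable_basis_projection: "adjointable ipE (basis_projection B)"
  unfolding adjointable_def using basis_projection_adjoint by blast

lemma uminus_basis_projection_in_compact_ops_E:
  assumes "finite B"
  shows "(\<lambda>z. - basis_projection B z) \<in> compact_ops_E scE act ipE"
proof -
  have "adjointable ipE (\<lambda>z. - basis_projection B z)"
    unfolding adjointable_def
    by (intro exI[of _ "\<lambda>z. - basis_projection B z"] allI)
      (simp add: fun_eq_iff ipE_minus basis_projection_adjoint)
  moreover obtain f where f: "bij_betw f {0..<card B} B" using ex_bij_betw_nat_finite[OF assms] by blast
  have "(\<lambda>z. - basis_projection B z) = (\<lambda>z. \<Sum>i<card B. scE (-1) (Theta act ipE (f i) (f i) z))"
    by (simp add: basis_projection_def fun_eq_iff sum_negf sum.reindex_bij_betw[OF f, symmetric] atLeast0LessThan)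
  then have "(\<lambda>z. - basis_projection B z) \<in> Theta_span scE act ipE"
    unfolding Theta_span_def
    by (intro CollectI exI[of _ "card B"] exI[of _ "\<lambda>_. -1"] exI[of _ f])
  then have "\<exists>F\<in>Theta_span scE act ipE. onorm (\<lambda>z. - basis_projection B z - F z) < \<epsilon>" if "\<epsilon> > 0" for \<epsilon>
    using that by (intro bexI[of _ "\<lambda>z. - basis_projection B z"]) (simp_all add: onorm_zero)
  ultimately show ?thesis by (simp add: compact_ops_E_def)
qed

lemma act_zero_left: "act (\<lambda>_. 0) x = 0"
  using act_sc_left[OF ipE_in_K, of 0 x x x] by simp

lemma basis_projection_in:
  assumes "orthonormal_basis scH ipH act ipE X B" "submodule scH scE act X"
  shows "basis_projection B x \<in> X"
proof -
  have BX: "B \<subseteq> X" using assms(1) by (simp add: orthonormal_basis_def orthonormal_system_def)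
  have "(\<Sum>b\<in>C. Theta act ipE b b x) \<in> X" if "C \<subseteq> B" for C
    using that
  proof (induction C rule: infinite_finite_induct)
    case (insert b C)
    then show ?case using assms(2) BX ipE_in_K by (auto simp: submodule_def Theta_def)
  qed (use assms(2) in \<open>auto simp: submodule_def\<close>)
  then show ?thesis unfolding basis_projection_def by blast
qed

text \<open>The projection fixes each basis vector by \<open>act_ipE_self\<close>, commutes with the
  action, and has a closed set of fixed points, which therefore contains the closure of the
  generated submodule.\<close>

lemma basis_projection_id:
  assumes B: "orthonormal_basis scH ipH act ipE X B" "finite B" and x: "x \<in> X"
  shows "basis_projection B x = x"
proof -
  let ?gen = "generated_submodule scH act B"
  note adj = adjointable_basis_projection[of B]
  have bl: "bounded_linear (basis_projection B)" by (rule adjointable_bounded_linear[OF adj])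
  have b: "basis_projection B b = b" if "b \<in> B" for b
  proof -
    have "basis_projection B b = (\<Sum>b'\<in>B. if b' = b then b else 0)"
      unfolding basis_projection_def Theta_def
      using B(1) that by (intro sum.cong)
        (auto simp: orthonormal_basis_def orthonormal_system_def act_zero_left act_ipE_self)
    then show ?thesis using that B(2) by simp
  qed
  have "?gen \<subseteq> {x. basis_projection B x = x}"
  proof
    fix x assume "x \<in> ?gen"
    then obtain n a bs where x: "x = (\<Sum>i<(n::nat). act (a i) (bs i))" "\<forall>i<n. a i \<in> K \<and> bs i \<in> B"
      unfolding generated_submodule_def by blast
    have "basis_projection B x = (\<Sum>i<n. basis_projection B (act (a i) (bs i)))"
      using linear_sum[OF bounded_linear.linear[OF bl]] x(1) by simp
    also have "\<dots> = x" using x by (simp add: adjointable_act[OF adj] b)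
    finally show "x \<in> {x. basis_projection B x = x}" by simp
  qed
  moreover have "closed {x. basis_projection B x = x}"
    by (intro closed_Collect_eq linear_continuous_on[OF bl] continuous_on_id)
  ultimately have "closure ?gen \<subseteq> {x. basis_projection B x = x}" by (rule closure_minimal)
  then show ?thesis using B(1) x by (auto simp: orthonormal_basis_def)
qed

text \<open>Otherwise there are unit vectors \<open>y n\<close> in \<open>G\<close> with
  \<open>Q (y n) = 0\<close> and \<open>T (y n)\<close> tending to 0. Compactness of
  \<open>?k\<close> makes a subsequence converge to a unit vector killed by both \<open>T\<close>
  and \<open>Q\<close>, against \<open>ker\<close>.\<close>

lemma bounded_below_on_G:
  assumes S: "bounded_linear S" and T: "bounded_linear T" and Q: "bounded_linear Q"
    and k: "precompact_on_G (\<lambda>z. S (T z) - z)"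
    and ker: "\<And>x. T x = 0 \<Longrightarrow> Q x = x"
  shows "\<exists>c>0. \<forall>x\<in>G. Q x = 0 \<longrightarrow> c * norm x \<le> norm (T x)"
proof (rule ccontr)
  assume neg: "\<not> ?thesis"
  interpret S: bounded_linear S by fact
  interpret T: bounded_linear T by fact
  interpret Q: bounded_linear Q by fact
  let ?k = "\<lambda>z. S (T z) - z"
  have "\<exists>y\<in>G. Q y = 0 \<and> norm y = 1 \<and> norm (T y) \<le> 1 / real (Suc n)" for n
  proof -
    have "1 / real (Suc n) > 0" by simp
    then obtain x where x: "x \<in> G" "Q x = 0" "norm (T x) < 1 / real (Suc n) * norm x"
      using neg by (meson not_le)
    then have x0: "x \<noteq> 0" by auto
    let ?y = "(1 / norm x) *\<^sub>R x"
    have "?y \<in> G" using G.G_sc[OF x(1)] by (simp only: scaleR_scE)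
    moreover have "norm (T x) / norm x \<le> 1 / real (Suc n)"
      using less_imp_le[OF x(3)] x0 by (subst pos_divide_le_eq) auto
    then have "norm (T ?y) \<le> 1 / real (Suc n)" by (simp add: T.scaleR)
    ultimately show ?thesis using x(2) x0 by (intro bexI[of _ ?y]) (auto simp: Q.scaleR)
  qed
  then obtain y where y: "\<And>n. y n \<in> G" "\<And>n. Q (y n) = 0" "\<And>n. norm (y n) = 1"
    "\<And>n. norm (T (y n)) \<le> 1 / real (Suc n)" by metis
  have "\<forall>n. ?k (y n) \<in> closure (?k ` (G \<inter> cball 0 1))"
    using y by (intro allI subsetD[OF closure_subset] imageI) auto
  then obtain l r where r: "strict_mono (r :: nat \<Rightarrow> nat)" "((\<lambda>n. ?k (y n)) \<circ> r) \<longlonglongrightarrow> l"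
    using precompact_on_G_compact_closure[OF k]
      compact_def[THEN iffD1, rule_format, of "closure (?k ` (G \<inter> cball 0 1))" "\<lambda>n. ?k (y n)"] by blast
  have "(\<lambda>n. T (y n)) \<longlonglongrightarrow> 0"
    by (rule Lim_null_comparison[OF _ LIMSEQ_Suc[OF lim_1_over_n]]) (use y(4) in auto)
  then have Tr: "(\<lambda>n. T (y (r n))) \<longlonglongrightarrow> 0"
    using LIMSEQ_subseq_LIMSEQ[OF _ r(1)] by (fastforce simp: comp_def)
  then have "(\<lambda>n. S (T (y (r n)))) \<longlonglongrightarrow> S 0" by (rule S.tendsto)
  \<comment> \<open>The difference is \<open>y (r n)\<close> itself, so convergence of both terms
    gives that of the vectors.\<close>
  then have "(\<lambda>n. S (T (y (r n))) - ?k (y (r n))) \<longlonglongrightarrow> S 0 - l"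
    using r(2) by (intro tendsto_diff) (simp_all add: comp_def)
  then have yl: "(\<lambda>n. y (r n)) \<longlonglongrightarrow> - l" by (simp add: S.zero)
  have "T (- l) = 0" using LIMSEQ_unique[OF T.tendsto[OF yl] Tr] .
  then have "Q (- l) = - l" by (rule ker)
  moreover have "(\<lambda>n. Q (y (r n))) \<longlonglongrightarrow> Q (- l)" by (rule Q.tendsto[OF yl])
  then have "Q (- l) = 0" using y(2) by (simp add: LIMSEQ_const_iff)
  moreover have "(\<lambda>n. norm (y (r n))) \<longlonglongrightarrow> norm (- l)" by (rule tendsto_norm[OF yl])
  then have "norm (- l) = 1" using y(3) by (simp add: LIMSEQ_const_iff)
  ultimately show False by simp
qed

text \<open>\<open>Q\<close> and \<open>T\<close> commute with each \<open>fib h\<close>, so the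
  bound on \<open>G\<close> applies to all \<open>fib h x\<close>, and \<open>norm_le_fib\<close>
  returns it to \<open>x\<close> with the same constant.\<close>

lemma bounded_below:
  assumes S: "adjointable ipE S" and T: "adjointable ipE T" and Q: "adjointable ipE Q"
    and k: "(\<lambda>z. S (T z) - z) \<in> compact_ops_E scE act ipE"
    and ker: "\<And>x. T x = 0 \<Longrightarrow> Q x = x"
  shows "\<exists>c>0. \<forall>x. Q x = 0 \<longrightarrow> c * norm x \<le> norm (T x)"
proof -
  obtain c where c: "c > 0" "\<And>x. x \<in> G \<Longrightarrow> Q x = 0 \<Longrightarrow> c * norm x \<le> norm (T x)"
    using bounded_below_on_G[OF adjointable_bounded_linear[OF S] adjointable_bounded_linear[OF T]
        adjointable_bounded_linear[OF Q] precompact_on_G_compact_ops_E[OF k] ker] by blast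
  have "c * norm x \<le> norm (T x)" if x: "Q x = 0" for x
  proof -
    have "norm x \<le> norm (T x) / c"
    proof (rule norm_le_fib)
      fix h
      have "Q (fib h x) = 0"
        using x by (simp add: adjointable_fib[OF Q]) (simp add: fib_def act_zero rank_one_in_K)
      then have "c * norm (fib h x) \<le> norm (T (fib h x))" by (intro c fib_in_G)
      also have "\<dots> \<le> norm h * norm (T x)" unfolding adjointable_fib[OF T] by (rule norm_fib_le)
      finally show "norm (fib h x) \<le> norm (T x) / c * norm h" using c(1) by (simp add: field_simps)
    qed (use c in simp)
    then show ?thesis using c(1) by (simp add: field_simps)
  qed
  then show ?thesis using c(1) by blast
qed

lemma fredholm_imp_closed_range_finite_kernels:
  assumes T: "adjointable ipE T" and fr: "fredholm scE act ipE T"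
  shows "closed (range T) \<and> finite_dimK scH ipH act ipE {x. T x = 0} \<and>
    finite_dimK scH ipH act ipE {x. adjE ipE T x = 0}"
proof -
  obtain S where S: "adjointable ipE S" and k1: "(\<lambda>z. S (T z) - z) \<in> compact_ops_E scE act ipE"
    and k2: "(\<lambda>z. T (S z) - z) \<in> compact_ops_E scE act ipE"
    using fr by (auto simp: fredholm_def)
  interpret S: bounded_linear S by (rule adjointable_bounded_linear[OF S])
  interpret T: bounded_linear T by (rule adjointable_bounded_linear[OF T])
  note kerT = submodule_kernel[OF T] and kerT' = submodule_kernel[OF adjointable_adjE_self[OF T]]
  define B where "B = (SOME B. orthonormal_basis scH ipH act ipE {x. T x = 0} B)"
  define B' where "B' = (SOME B. orthonormal_basis scH ipH act ipE {x. adjE ipE T x = 0} B)"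
  have B: "orthonormal_basis scH ipH act ipE {x. T x = 0} B"
    unfolding B_def by (rule someI_ex[OF orthonormal_basis_exists[OF kerT]])
  have B': "orthonormal_basis scH ipH act ipE {x. adjE ipE T x = 0} B'"
    unfolding B'_def by (rule someI_ex[OF orthonormal_basis_exists[OF kerT']])
  have finB: "finite B"
    by (rule orthonormal_system_finite[OF _ kerT(1) k1])
      (use B in \<open>auto simp: orthonormal_basis_def S.zero ipE_minus\<close>)
  \<comment> \<open>\<open>T S - 1\<close> need not be minus the identity on the kernel of the
    adjoint, but its compression is: \<langle>TSx, y\<rangle> vanishes when the adjoint kills
    y.\<close>
  have finB': "finite B'"
    by (rule orthonormal_system_finite[OF _ kerT'(1) k2])
      (use B' in \<open>auto simp: orthonormal_basis_def ipE_diff adjointable_adjE[OF T] ipE_zero\<close>)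
  let ?Q = "basis_projection B"
  note adjQ = adjointable_basis_projection[of B]
  have Qid: "?Q x = x" if "T x = 0" for x using basis_projection_id[OF B finB, of x] that by simp
  have TQ: "T (?Q x) = 0" for x using basis_projection_in[OF B kerT(1), of x] by simp
  obtain c where c: "c > 0" "\<forall>x\<in>{x. ?Q x = 0}. c * norm x \<le> norm (T x)"
    using bounded_below[OF S T adjQ k1 Qid] by blast
  interpret Q: bounded_linear ?Q by (rule adjointable_bounded_linear[OF adjQ])
  \<comment> \<open>\<open>T\<close> is bounded below on the kernel of \<open>?Q\<close>, so the
    image of this closed subspace is complete. It is the whole range because \<open>x - ?Q x\<close>
    and \<open>x\<close> have the same image.\<close>
  have "complete (T ` {x. ?Q x = 0})"
  proof (rule complete_isometric_image[OF c(1) _ T.bounded_linear_axioms c(2)])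
    show "subspace {x. ?Q x = 0}" by (rule subspaceI) (auto simp: Q.zero Q.add Q.scaleR)
    show "complete {x. ?Q x = 0}" using submodule_kernel(2)[OF adjQ] by (simp add: complete_eq_closed)
  qed
  moreover have "T ` {x. ?Q x = 0} = range T"
  proof (intro equalityI subsetI)
    fix y assume "y \<in> range T"
    then obtain x where "y = T x" by blast
    then have "y = T (x - ?Q x)" "?Q (x - ?Q x) = 0"
      using Qid[OF TQ] by (simp_all add: T.diff TQ Q.diff)
    then show "y \<in> T ` {x. ?Q x = 0}" by blast
  qed auto
  ultimately have "closed (range T)" using complete_imp_closed by metis
  then show ?thesis using finB finB' by (simp add: finite_dimK_def B_def B'_def)
qed

text \<open>The lower bound gives injectivity and a closed range. A vector orthogonal to the range
  lies in the kernel by self-adjointness, so the range is everything.\<close>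

lemma selfadjoint_bounded_below_bij:
  assumes A: "\<And>x y. ipE (A x) y = ipE x (A y)" and c: "c > 0" "\<And>x. c * norm x \<le> norm (A x)"
  shows "bij A"
proof -
  have adj: "adjointable ipE A" using A by (auto simp: adjointable_def)
  interpret A: bounded_linear A by (rule adjointable_bounded_linear[OF adj])
  have zero: "x = 0" if "A x = 0" for x
  proof -
    have "c * norm x \<le> 0" using c(2)[of x] that by simp
    then show ?thesis using c(1) by (simp add: mult_le_0_iff)
  qed
  have "complete (range A)"
    by (rule complete_isometric_image[OF c(1) subspace_UNIV A.bounded_linear_axioms]) (auto simp: c(2) complete_UNIV)
  then have closed: "closed (range A)" by (rule complete_imp_closed)
  have "UNIV \<subseteq> range A"
  proof (rule ccontr)
    assume "\<not> UNIV \<subseteq> range A"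
    then obtain z where z: "norm z = 1" "\<And>y h. y \<in> range A \<Longrightarrow> ipE z y h = 0"
      using closed_submodule_orthogonal_vector[OF submodule_range[OF adj] closed, of UNIV]
      by (auto simp: submodule_def)
    have "A z = 0" by (rule ipE_self_zeroD) (simp add: A z(2))
    then show False using zero z(1) by fastforce
  qed
  moreover have "inj A"
    by (rule injI) (metis A.diff zero eq_iff_diff_eq_0)
  ultimately show ?thesis by (auto simp: bij_def)
qed

lemma closed_range_finite_kernels_imp_fredholm:
  assumes T: "adjointable ipE T" and cl: "closed (range T)"
    and fin: "finite_dimK scH ipH act ipE {x. T x = 0}" "finite_dimK scH ipH act ipE {x. adjE ipE T x = 0}"
  shows "fredholm scE act ipE T"
proof -
  let ?T' = "adjE ipE T"
  note T' = adjointable_adjE_self[OF T]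
  interpret T: bounded_linear T by (rule adjointable_bounded_linear[OF T])
  interpret T': bounded_linear ?T' by (rule adjointable_bounded_linear[OF T'])
  note kerT = submodule_kernel[OF T] and kerT' = submodule_kernel[OF T']
  obtain B where B: "orthonormal_basis scH ipH act ipE {x. T x = 0} B" "finite B"
    using finite_dimK_basisE[OF kerT fin(1)] .
  obtain B' where B': "orthonormal_basis scH ipH act ipE {x. ?T' x = 0} B'" "finite B'"
    using finite_dimK_basisE[OF kerT' fin(2)] .
  define Q where "Q = basis_projection B"
  define Q' where "Q' = basis_projection B'"
  have adjQ: "adjointable ipE Q" unfolding Q_def by (rule adjointable_basis_projection)
  have ipQ: "ipE (Q x) y = ipE x (Q y)" and ipQ': "ipE (Q' x) y = ipE x (Q' y)" for x y
    by (simp_all add: Q_def Q'_def basis_projection_adjoint)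
  interpret Q: bounded_linear Q by (rule adjointable_bounded_linear[OF adjQ])
  have TQ: "T (Q x) = 0" for x using basis_projection_in[OF B(1) kerT(1), of x] by (simp add: Q_def)
  have TQ': "?T' (Q' x) = 0" for x using basis_projection_in[OF B'(1) kerT'(1), of x] by (simp add: Q'_def)
  have Qid: "Q x = x" if "T x = 0" for x using basis_projection_id[OF B, of x] that by (simp add: Q_def)
  have Qid': "Q' x = x" if "?T' x = 0" for x using basis_projection_id[OF B', of x] that by (simp add: Q'_def)
  have QT: "Q (?T' x) = 0" for x
    by (rule ipE_ext) (simp add: ipQ adjE_adjoint[OF T] TQ ipE_zero)
  have QT': "Q' (T x) = 0" for x
    by (rule ipE_ext) (simp add: ipQ' adjointable_adjE[OF T] TQ' ipE_zero)
  have QQ: "Q (Q x) = Q x" for x by (rule Qid[OF TQ])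
  obtain M where M: "M > 0" "\<And>x. norm (Q x) \<le> norm x * M" using Q.pos_bounded by blast
  obtain C where C: "C \<ge> 0" "\<And>y. y \<in> range T \<Longrightarrow> \<exists>x. T x = y \<and> norm x \<le> C * norm y"
    using open_mapping_closed_subspace[OF T.bounded_linear_axioms subspace_UNIV closed_UNIV cl] by auto
  define D where "D = (1 + M) * C + 1"
  have D: "D > 0" using M C by (simp add: D_def add_nonneg_pos)
  \<comment> \<open>The open mapping theorem gives \<open>x\<close> with the same image as
    \<open>u\<close> and controlled norm. Then \<open>u - x\<close> lies in the kernel of
    \<open>T\<close>, whence \<open>u = x - Q x\<close>.\<close>
  have below: "norm u \<le> D * norm (T u)" if u: "Q u = 0" for u
  proof -
    obtain x where x: "T x = T u" "norm x \<le> C * norm (T u)" using C(2) by blast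
    have "Q (u - x) = u - x" by (rule Qid) (simp add: T.diff x)
    then have "u - x = - Q x" using u by (simp add: Q.diff)
    then have "x + (u - x) = x - Q x" by simp
    then have "u = x - Q x" by simp
    then have "norm u \<le> norm x + norm (Q x)" using norm_triangle_ineq4 by metis
    also have "\<dots> \<le> (1 + M) * norm x" using M(2)[of x] by (simp add: algebra_simps)
    also have "\<dots> \<le> (1 + M) * (C * norm (T u))" using x(2) M(1) by (intro mult_left_mono) auto
    also have "\<dots> \<le> D * norm (T u)" by (simp add: D_def algebra_simps)
    finally show ?thesis .
  qed
  define A where "A x = ?T' (T x) + Q x" for x
  have ipA: "ipE (A x) y = ipE x (A y)" for x y
    by (rule ext) (simp add: A_def ipE_add ipE_add_right ipQ adjE_adjoint[OF T] adjointable_adjE[OF T])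
  \<comment> \<open>Split \<open>x\<close> as \<open>u + Q x\<close>. Applying \<open>Q\<close> to
    \<open>A x\<close> recovers \<open>Q x\<close>, and the rest of \<open>A x\<close> is
    \<open>?T' (T u)\<close>, which controls \<open>u\<close>.\<close>
  have lower: "norm x \<le> (D\<^sup>2 * (1 + M) + M) * norm (A x)" for x
  proof -
    define u where "u = x - Q x"
    have Qu: "Q u = 0" by (simp add: u_def Q.diff QQ)
    have Tu: "T u = T x" by (simp add: u_def T.diff TQ)
    have QA: "Q (A x) = Q x" by (simp add: A_def Q.add QT QQ)
    then have v: "norm (Q x) \<le> M * norm (A x)" using M(2)[of "A x"] by (simp add: mult.commute)
    have "?T' (T u) = A x - Q (A x)" unfolding QA Tu by (simp add: A_def)
    then have "norm (?T' (T u)) \<le> norm (A x) + norm (Q (A x))" using norm_triangle_ineq4 by metis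
    then have tt: "norm (?T' (T u)) \<le> (1 + M) * norm (A x)"
      using M(2)[of "A x"] by (simp add: algebra_simps)
    \<comment> \<open>The inner square of \<open>T u\<close> is that of \<open>u\<close> with
      \<open>?T' (T u)\<close>. Combined with \<open>below\<close>, one factor \<open>norm u\<close>
      cancels and leaves a lower bound for \<open>?T' (T u)\<close>.\<close>
    have "(norm (T u))\<^sup>2 \<le> norm (?T' (T u)) * norm u"
      by (rule norm_sq_le)
        (simp_all add: adjointable_adjE[OF T] norm_ipE_le[of u "?T' (T u)", simplified mult.commute[of "norm u"]])
    have "(norm u)\<^sup>2 \<le> (D * norm (T u))\<^sup>2" using below[OF Qu] by (intro power_mono) auto
    also have "\<dots> \<le> D\<^sup>2 * (norm (?T' (T u)) * norm u)"
      unfolding power_mult_distrib by (intro mult_left_mono) (fact, simp)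
    finally have "norm u * norm u \<le> (D\<^sup>2 * norm (?T' (T u))) * norm u" by (simp add: power2_eq_square mult_ac)
    then have "norm u \<le> D\<^sup>2 * norm (?T' (T u))" by (cases "u = 0") auto
    also have "\<dots> \<le> D\<^sup>2 * ((1 + M) * norm (A x))" by (intro mult_left_mono tt) simp
    finally have nu: "norm u \<le> D\<^sup>2 * ((1 + M) * norm (A x))" .
    have "norm x \<le> norm u + norm (Q x)" using norm_triangle_ineq[of u "Q x"] by (simp add: u_def)
    then show ?thesis using nu v by (simp add: algebra_simps)
  qed
  define N where "N = D\<^sup>2 * (1 + M) + M"
  have N: "N > 0" using M(1) by (simp add: N_def add_nonneg_pos)
  have "1 / N * norm x \<le> norm (A x)" for x
    using lower[of x, folded N_def] N by (simp add: field_simps)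
  then have bij: "bij A"
    using N by (intro selfadjoint_bounded_below_bij[OF ipA, of "1 / N"]) auto
  define R where "R = inv A"
  have AR: "A (R x) = x" and RA: "R (A x) = x" for x
    using bij by (simp_all add: R_def bij_is_surj surj_f_inv_f bij_is_inj)
  have ipR: "ipE (R x) y = ipE x (R y)" for x y
    using ipA[of "R x" "R y"] by (simp add: AR)
  define S where "S x = R (?T' x)" for x
  have ipS: "ipE (S x) y = ipE x (T (R y))" for x y
    by (simp add: S_def ipR adjE_adjoint[OF T])
  have adjS: "adjointable ipE S"
    unfolding adjointable_def by (intro exI[of _ "\<lambda>y. T (R y)"] allI ipS)
  have adjR: "adjointable ipE R" using ipR by (auto simp: adjointable_def)
  interpret R: bounded_linear R by (rule adjointable_bounded_linear[OF adjR])
  \<comment> \<open>\<open>A\<close> is the identity on the range of \<open>Q\<close>, hence so is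
    its inverse.\<close>
  have RQ: "R (Q x) = Q x" for x
    using RA[of "Q x"] by (simp add: A_def TQ T'.zero QQ)
  have "S (T x) = R (A x - Q x)" for x by (simp add: S_def A_def)
  then have ST: "S (T x) - x = - Q x" for x by (simp add: R.diff RA RQ)
  have TST: "T (S (T x)) = T x" for x
  proof -
    have "S (T x) = x - Q x" using ST[of x] by (simp add: algebra_simps)
    then show ?thesis by (simp add: T.diff TQ)
  qed
  \<comment> \<open>\<open>T S\<close> is self-adjoint, being \<open>T R ?T'\<close> with
    \<open>R\<close> self-adjoint; the claim is the adjoint of \<open>TST\<close>.\<close>
  have T'TS: "?T' (T (S x)) = ?T' x" for x
  proof (rule ipE_ext)
    fix z h
    have TS: "ipE (T (S x)) y = ipE x (T (S y))" for y
      using adjointable_adjE[OF T, of "S x" y] ipS[of x "?T' y"] by (simp only: S_def)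
    show "ipE (?T' (T (S x))) z h = ipE (?T' x) z h"
      by (simp add: adjE_adjoint[OF T] TS TST)
  qed
  \<comment> \<open>By \<open>T'TS\<close> the left side lies in the kernel of \<open>?T'\<close>,
    so \<open>Q'\<close> fixes it; \<open>Q'\<close> also kills the range of \<open>T\<close>,
    leaving only \<open>- Q' x\<close>.\<close>
  have TS: "T (S x) - x = - Q' x" for x
  proof -
    have "Q' (T (S x) - x) = T (S x) - x" by (rule Qid') (simp add: T'.diff T'TS)
    moreover have "Q' (T (S x) - x) = Q' (T (S x)) - Q' x"
      by (rule linear_diff, rule bounded_linear.linear, rule adjointable_bounded_linear)
        (simp add: Q'_def adjointable_basis_projection)
    ultimately show ?thesis by (simp add: QT')
  qed
  have "(\<lambda>z. S (T z) - z) \<in> compact_ops_E scE act ipE" "(\<lambda>z. T (S z) - z) \<in> compact_ops_E scE act ipE"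
    unfolding ST TS Q_def Q'_def by (intro uminus_basis_projection_in_compact_ops_E B B')+
  then show ?thesis using adjS by (auto simp: fredholm_def)
qed

end

theorem theorem3p7:
  fixes scH :: "complex \<Rightarrow> 'h::banach \<Rightarrow> 'h" and ipH :: "'h \<Rightarrow> 'h \<Rightarrow> complex"
    and scE :: "complex \<Rightarrow> 'e::banach \<Rightarrow> 'e" and act :: "('h \<Rightarrow> 'h) \<Rightarrow> 'e \<Rightarrow> 'e"
    and ipE :: "'e \<Rightarrow> 'e \<Rightarrow> ('h \<Rightarrow> 'h)" and T :: "'e \<Rightarrow> 'e"
  assumes "hilbert_K_module scH ipH scE act ipE"
    and "adjointable ipE T"
  shows "fredholm scE act ipE T \<longleftrightarrow>
           (closed (range T) \<and> submodule scH scE act (range T) \<and>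
            finite_dimK scH ipH act ipE {x. T x = 0} \<and>
            finite_dimK scH ipH act ipE {x. adjE ipE T x = 0})"
proof (cases "\<exists>h :: 'h. h \<noteq> 0")
  \<comment> \<open>If \<open>H = 0\<close> then \<open>E = 0\<close>, and there is no minimal projection to work with.\<close>
  case True
  then obtain h :: 'h where "h \<noteq> 0" by blast
  then interpret hilbert_module_over_K_unit scH ipH scE act ipE "(1 / norm h) *\<^sub>R h"
    by unfold_locales (use assms in simp_all)
  show ?thesis
    using fredholm_imp_closed_range_finite_kernels[OF assms(2)]
      closed_range_finite_kernels_imp_fredholm[OF assms(2)] submodule_range[OF assms(2)] by blast
next
  case False
  interpret hilbert_module_over_K scH ipH scE act ipE by unfold_locales fact
  have H0: "h = 0" for h :: 'h using False by blast
  have E0: "x = 0" for x :: 'e using H0 by (intro ipE_self_zeroD)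
  have fin: "finite A" for A :: "'e set"
    by (rule finite_subset[of _ "{0}"]) (use E0 in auto)
  have adj: "adjointable ipE F" for F :: "'e \<Rightarrow> 'e"
    unfolding adjointable_def by (intro exI[of _ F] allI ext) (metis H0)
  have "(\<lambda>z. 0) \<in> Theta_span scE act ipE"
    unfolding Theta_span_def by (intro CollectI exI[of _ 0]) auto
  moreover have "onorm F = 0" for F :: "'e \<Rightarrow> 'e"
  proof -
    have "F = (\<lambda>_. 0)" using E0 by (intro ext)
    then show ?thesis by (simp add: onorm_zero)
  qed
  ultimately have "F \<in> compact_ops_E scE act ipE" for F :: "'e \<Rightarrow> 'e"
    using adj[of F] unfolding compact_ops_E_def
    by (intro CollectI conjI allI impI bexI[of _ "\<lambda>z. 0"]) simp_all
  then have "fredholm scE act ipE T" using assms(2) by (auto simp: fredholm_def)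
  moreover have "range T = UNIV" using E0 by (metis UNIV_eq_I rangeI)
  ultimately show ?thesis
    by (simp add: finite_dimK_def fin submodule_def)
qed

end
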